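(* Let $\Phi$ be a commutative ring with unity $1\neq 0$, and let $\Delta$ be a basic set of derivation operators containing at least two elements. Then the subalgebra membership problem for differential polynomial algebras $\Phi\{x_1,\ldots,x_n\}$ (with respect to $\Delta$) is algorithmically undecidable: there is no algorithm which, for every finite sequence of differential polynomials $f,f_1,\ldots,f_k\in\Phi\{x_1,\ldots,x_n\}$, determines whether $f$ belongs to the differential subalgebra generated by $f_1,\ldots,f_k$.
   Context: $\Delta=\{\delta_1,\ldots,\delta_m\}$ is a set of symbols for commuting derivations. $\Phi$ is regarded as a differential ring on which all $\delta_i$ act as zero. The differential polynomial ring $\Phi\{x_1,\ldots,x_n\}$ is the polynomial ring over $\Phi$ in the algebraically independent variables $\theta(x_i)$, where $1\le i\le n$ and $\theta=\delta_1^{j_1}\cdots\delta_m^{j_m}$ ranges over the free commutative monoid generated by $\Delta$; each $\delta_l$ acts as the unique derivation with $\delta_l(\theta(x_i))=(\delta_l\theta)(x_i)$ and $\delta_l(\Phi)=0$. The differential subalgebra generated by a set is the smallest $\Phi$-subalgebra (with unity) containing the set and closed under all $\delta_l$. *)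

theory Defs
  imports Main "HOL-Library.Poly_Mapping" "HOL-Library.Nat_Bijection"
begin

text \<open>Derivation operators are delta_0, ..., delta_(m-1) (indices l < m).
  A derivative operator theta = delta_0^j_0 ... delta_(m-1)^j_(m-1) is represented by the
  finitely supported exponent map (l maps to j_l).  The algebraic variable theta(x_i) is the pair (i, theta).
  Polynomials over Phi in these variables are finitely supported maps from monomials
  (finitely supported exponent maps on variables) to coefficients.\<close>

type_synonym dvar = "nat \<times> (nat \<Rightarrow>\<^sub>0 nat)"
type_synonym 'a dpoly = "(dvar \<Rightarrow>\<^sub>0 nat) \<Rightarrow>\<^sub>0 'a"

definition dX :: "dvar \<Rightarrow> 'a::comm_ring_1 dpoly" where
  "dX v = Poly_Mapping.single (Poly_Mapping.single v 1) 1"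

definition dmonom :: "(dvar \<Rightarrow>\<^sub>0 nat) \<Rightarrow> 'a::comm_ring_1 \<Rightarrow> 'a dpoly" where
  "dmonom mm c = Poly_Mapping.single mm c"

definition dconst :: "'a::comm_ring_1 \<Rightarrow> 'a dpoly" where
  "dconst c = Poly_Mapping.single 0 c"

definition dshift :: "nat \<Rightarrow> dvar \<Rightarrow> dvar" where
  "dshift l v = (fst v, snd v + Poly_Mapping.single l 1)"

text \<open>The unique derivation delta_l with delta_l(theta x_i) = (delta_l theta) x_i and delta_l(Phi) = 0:
  it is Phi-linear and acts on a monomial by the Leibniz rule.\<close>
definition dderiv_monom :: "nat \<Rightarrow> (dvar \<Rightarrow>\<^sub>0 nat) \<Rightarrow> 'a::comm_ring_1 \<Rightarrow> 'a dpoly" where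
  "dderiv_monom l mm c =
     (\<Sum>v\<in>Poly_Mapping.keys mm. dmonom (mm - Poly_Mapping.single v 1) (c * of_nat (Poly_Mapping.lookup mm v))
                       * dX (dshift l v))"

definition dderiv :: "nat \<Rightarrow> 'a::comm_ring_1 dpoly \<Rightarrow> 'a dpoly" where
  "dderiv l p = (\<Sum>mm\<in>Poly_Mapping.keys p. dderiv_monom l mm (Poly_Mapping.lookup p mm))"

definition dpolys :: "nat \<Rightarrow> nat \<Rightarrow> 'a::comm_ring_1 dpoly set" where
  "dpolys m n = {p. \<forall>mm\<in>Poly_Mapping.keys p. \<forall>v\<in>Poly_Mapping.keys mm. fst v < n \<and> Poly_Mapping.keys (snd v) \<subseteq> {..<m}}"

inductive_set dsubalg :: "nat \<Rightarrow> 'a::comm_ring_1 dpoly set \<Rightarrow> 'a dpoly set"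
  for m :: nat and S :: "'a dpoly set" where
  gen: "s \<in> S \<Longrightarrow> s \<in> dsubalg m S"
| const: "dconst c \<in> dsubalg m S"
| add: "p \<in> dsubalg m S \<Longrightarrow> q \<in> dsubalg m S \<Longrightarrow> p + q \<in> dsubalg m S"
| mult: "p \<in> dsubalg m S \<Longrightarrow> q \<in> dsubalg m S \<Longrightarrow> p * q \<in> dsubalg m S"
| deriv: "l < m \<Longrightarrow> p \<in> dsubalg m S \<Longrightarrow> dderiv l p \<in> dsubalg m S"

text \<open>A factor (i, js, e) stands for (theta x_i)^e with theta = prod_l delta_l^(js!l);
  a term (c, factors) stands for c * product of factors, with c an integer (image of Z in Phi);
  a description is a list of terms standing for their sum.\<close>
type_synonym dfactor = "nat \<times> nat list \<times> nat"
type_synonym dterm = "int \<times> dfactor list"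
type_synonym ddesc = "dterm list"

definition theta_of :: "nat list \<Rightarrow> (nat \<Rightarrow>\<^sub>0 nat)" where
  "theta_of js = (\<Sum>l<length js. Poly_Mapping.single l (js ! l))"

definition interp_factor :: "dfactor \<Rightarrow> 'a::comm_ring_1 dpoly" where
  "interp_factor fa = (case fa of (i, js, e) \<Rightarrow> dX (i, theta_of js) ^ e)"

definition interp_term :: "dterm \<Rightarrow> 'a::comm_ring_1 dpoly" where
  "interp_term t = dconst (of_int (fst t)) * prod_list (map interp_factor (snd t))"

definition interp :: "ddesc \<Rightarrow> 'a::comm_ring_1 dpoly" where
  "interp d = sum_list (map interp_term d)"

definition valid_desc :: "nat \<Rightarrow> nat \<Rightarrow> ddesc \<Rightarrow> bool" where
  "valid_desc m n d \<longleftrightarrow>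
     (\<forall>t\<in>set d. \<forall>fa\<in>set (snd t). fst fa < n \<and> length (fst (snd fa)) = m)"

definition encode_factor :: "dfactor \<Rightarrow> nat" where
  "encode_factor fa = (case fa of (i, js, e) \<Rightarrow> list_encode [i, list_encode js, e])"

definition encode_term :: "dterm \<Rightarrow> nat" where
  "encode_term t = prod_encode (int_encode (fst t), list_encode (map encode_factor (snd t)))"

definition encode_desc :: "ddesc \<Rightarrow> nat" where
  "encode_desc d = list_encode (map encode_term d)"

definition encode_instance :: "ddesc \<times> ddesc list \<Rightarrow> nat" where
  "encode_instance x = prod_encode (encode_desc (fst x), list_encode (map encode_desc (snd x)))"

datatype recf = Zero | Succ | Proj nat | Comp recf "recf list" | PrimRec recf recf | Minim recf

inductive reval :: "recf \<Rightarrow> nat list \<Rightarrow> nat \<Rightarrow> bool" where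
  zero: "reval Zero xs 0"
| succ: "reval Succ (x # xs) (Suc x)"
| proj: "i < length xs \<Longrightarrow> reval (Proj i) xs (xs ! i)"
| comp: "list_all2 (\<lambda>g y. reval g xs y) gs ys \<Longrightarrow> reval f ys z \<Longrightarrow> reval (Comp f gs) xs z"
| prim0: "reval f xs y \<Longrightarrow> reval (PrimRec f g) (0 # xs) y"
| primS: "reval (PrimRec f g) (k # xs) y \<Longrightarrow> reval g (k # y # xs) z
            \<Longrightarrow> reval (PrimRec f g) (Suc k # xs) z"
| minim: "reval f (k # xs) 0 \<Longrightarrow> (\<forall>j<k. \<exists>y. reval f (j # xs) (Suc y))
            \<Longrightarrow> reval (Minim f) xs k"

definition dsm_decidable :: "'a::comm_ring_1 itself \<Rightarrow> nat \<Rightarrow> nat \<Rightarrow> bool" where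
  "dsm_decidable _ m n \<longleftrightarrow>
     (\<exists>F. \<forall>f fs. valid_desc m n f \<and> (\<forall>g\<in>set fs. valid_desc m n g) \<longrightarrow>
        reval F [encode_instance (f, fs)]
          (if (interp f :: 'a dpoly) \<in> dsubalg m (interp ` set fs) then 1 else 0))"

end

(* A counter machine with a fixed set of registers can simulate any recursive function, with an
   unbounded stack coded in one register. Its state q is written as the monomial z^q w^(N-q), and its
   register r with content s as x_r f_r^(s), where ^(s) is the s-th derivative by delta_0. Let A be the
   differential algebra generated by all variables except t, by the first derivatives of t, by the products
   of t with the derivatives of z and w, by t times the accepting state, and by t times the difference of
   the two sides of each machine instruction. The elements h of A with t h in A form a differential ideal
   of A, in which all instructions and the accepting state lie; so t times a configuration lies in A if the
   machine accepts from it.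

   Conversely, treat t, z, w as constants and send f_r^(k) to S_r^k F_r and x_r^(k) to (-S_r)^k X_r. Then
   x_r f_r becomes a constant, hence the instruction x_r f_r (z^q w^(N-q) - z^p w^(N-p)) applies only to a
   register with content 0, and a functional that is nonzero exactly on the configurations from which the
   machine does not accept vanishes on A.

   If F decided membership, a machine could write down the code of the membership problem that asks
   whether it accepts its own input, and then do the opposite of what F answers. The registers, hence the
   variables, do not depend on F. *)

theory Submission
  imports Defs
begin

section \<open>Programs over registers\<close>

text \<open>\<open>RA\<close> holds input and output, \<open>RB\<close> a stack, and
  \<open>RX\<close>, \<open>RY\<close>, \<open>RZ\<close> local data. \<open>RC\<close>,
  \<open>RD\<close>, \<open>RE\<close> are scratch for copying, pairing, pushing and popping, which
  find them at zero and leave them so.\<close>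

datatype reg = RA | RB | RX | RY | RZ | RC | RD | RE

datatype cmd = Skip | Inc reg | Seq cmd cmd (infixr ";;" 60) | Loop reg cmd | Branch reg cmd cmd

inductive ex :: "cmd \<Rightarrow> (reg \<Rightarrow> nat) \<Rightarrow> (reg \<Rightarrow> nat) \<Rightarrow> bool" where
  ex_Skip: "ex Skip s s"
| ex_Inc: "ex (Inc r) s (s(r := Suc (s r)))"
| ex_Seq: "ex c s t \<Longrightarrow> ex d t u \<Longrightarrow> ex (c ;; d) s u"
| ex_Loop0: "s r = 0 \<Longrightarrow> ex (Loop r c) s s"
| ex_LoopS: "s r = Suc k \<Longrightarrow> ex c (s(r := k)) t \<Longrightarrow> ex (Loop r c) t u \<Longrightarrow> ex (Loop r c) s u"
| ex_Branch0: "s r = 0 \<Longrightarrow> ex d s t \<Longrightarrow> ex (Branch r c d) s t"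
| ex_BranchS: "s r = Suc k \<Longrightarrow> ex c (s(r := k)) t \<Longrightarrow> ex (Branch r c d) s t"

inductive_cases ex_SkipE: "ex Skip s t"
inductive_cases ex_IncE: "ex (Inc r) s t"
inductive_cases ex_SeqE: "ex (c ;; d) s t"
inductive_cases ex_LoopE: "ex (Loop r c) s t"
inductive_cases ex_BranchE: "ex (Branch r c d) s t"

lemma ex_det: "ex c s t \<Longrightarrow> ex c s u \<Longrightarrow> t = u"
proof (induction arbitrary: u rule: ex.induct)
  case ex_Skip then show ?case by (auto elim: ex_SkipE)
next
  case ex_Inc then show ?case by (auto elim: ex_IncE)
next
  case (ex_Seq c s t d u v)
  from ex_Seq.prems obtain w where w: "ex c s w" "ex d w v" by (rule ex_SeqE)
  from ex_Seq.IH(1)[OF w(1)] w(2) have "ex d t v" by (simp only:)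
  then show ?case by (rule ex_Seq.IH(2))
next
  case ex_Loop0 then show ?case by (auto elim: ex_LoopE)
next
  case (ex_LoopS s r k c t u v)
  from ex_LoopS.prems show ?case
  proof (rule ex_LoopE)
    fix k' t'
    assume "s r = Suc k'" "ex c (s(r := k')) t'" and v: "ex (Loop r c) t' v"
    with ex_LoopS.hyps(1) have "ex c (s(r := k)) t'" by simp
    then have "t = t'" by (rule ex_LoopS.IH(1))
    with v show ?thesis using ex_LoopS.IH(2)[of v] by simp
  qed (use ex_LoopS.hyps(1) in simp)
next
  case (ex_Branch0 s r d t c)
  from ex_Branch0.prems show ?case
  proof (rule ex_BranchE)
    assume "ex d s u"
    then show ?thesis by (rule ex_Branch0.IH)
  qed (use ex_Branch0.hyps(1) in simp)
next
  case (ex_BranchS s r k c t d)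
  from ex_BranchS.prems show ?case
  proof (rule ex_BranchE)
    fix k'
    assume "s r = Suc k'" "ex c (s(r := k')) u"
    with ex_BranchS.hyps(1) have "ex c (s(r := k)) u" by simp
    then show ?thesis by (rule ex_BranchS.IH)
  qed (use ex_BranchS.hyps(1) in simp)
qed

text \<open>Since execution is deterministic, a known run of a command turns into rewrite rules that
  let the simplifier execute a sequence symbolically.\<close>
lemma ex_iff: "ex c s u \<Longrightarrow> ex c s t \<longleftrightarrow> t = u"
  using ex_det by blast

lemma ex_seq_iff: "ex c s u \<Longrightarrow> ex (c ;; d) s t \<longleftrightarrow> ex d u t"
  by (metis ex_Seq ex_SeqE ex_det)

lemma ex_assoc: "ex ((c ;; d) ;; e) s t \<longleftrightarrow> ex (c ;; d ;; e) s t"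
  by (meson ex_Seq ex_SeqE)

lemma ex_Loop_iff: "s r = Suc k \<Longrightarrow> ex (Loop r c) s t \<longleftrightarrow> ex (c ;; Loop r c) (s(r := k)) t"
  by (rule iffI, erule ex_LoopE, auto intro: ex_LoopS ex_Seq elim!: ex_SeqE)

lemmas ex_basic = ex_iff[OF ex_Skip] ex_seq_iff[OF ex_Skip] ex_iff[OF ex_Inc] ex_seq_iff[OF ex_Inc]
  ex_iff[OF ex_Loop0] ex_seq_iff[OF ex_Loop0]

section \<open>Register macros: moving, copying, Cantor pairing and stacks\<close>

definition move :: "reg \<Rightarrow> reg \<Rightarrow> cmd" where "move r q = Loop r (Inc q)"
definition clear :: "reg \<Rightarrow> cmd" where "clear r = Loop r Skip"
definition copy :: "reg \<Rightarrow> reg \<Rightarrow> cmd" where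
  "copy r q = Loop r (Inc RC ;; Inc q) ;; move RC r"
text \<open>The first loop leaves the sum v + b in \<open>b\<close> and v in \<open>RC\<close>. The
  second adds the triangular number of that sum to \<open>RC\<close>, which gives the Cantor code
  \<open>prod_encode\<close>.\<close>

definition pair :: "reg \<Rightarrow> reg \<Rightarrow> cmd" where
  "pair v b = Loop v (Inc b ;; Inc RC) ;;
     Loop b (Inc RC ;; Loop b (Inc RD ;; Inc RC) ;; move RD b) ;; move RC b"
text \<open>The successor of a Cantor pair is how \<open>list_encode\<close> codes a cons, so stacks
  and argument lists share these macros.\<close>

definition push :: "reg \<Rightarrow> reg \<Rightarrow> cmd" where "push v b = pair v b ;; Inc b"
definition pushcopy :: "reg \<Rightarrow> reg \<Rightarrow> cmd" where "pushcopy v b = copy v RE ;; push RE b"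
text \<open>After the successor has been stripped, the loop counts the code down while the pair of
  contents of \<open>v\<close> and \<open>b\<close> runs through Cantor's enumeration: (v, b + 1) is
  followed by (v + 1, b), and (v, 0) by (0, v + 1).\<close>

definition pop :: "reg \<Rightarrow> reg \<Rightarrow> cmd" where
  "pop b v = Branch b Skip Skip ;; move b RC ;; Loop RC (Branch b (Inc v) (move v b ;; Inc b))"

lemma ex_move: "r \<noteq> q \<Longrightarrow> ex (move r q) s (s(r := 0, q := s q + s r))"
proof (induction "s r" arbitrary: s)
  case 0
  then have "s(r := 0, q := s q + s r) = s" by auto
  moreover have "ex (move r q) s s" using 0 by (simp add: move_def ex_basic)
  ultimately show ?case by (simp only:)
next
  case (Suc k)
  define s' where "s' = s(r := k, q := Suc (s q))"
  have "ex (move r q) s' (s'(r := 0, q := s' q + s' r))"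
    by (intro Suc(1)) (use Suc(2-) in \<open>simp_all add: s'_def\<close>)
  moreover have "s'(r := 0, q := s' q + s' r) = s(r := 0, q := s q + s r)"
    using Suc(2-) by (auto simp: s'_def fun_eq_iff)
  ultimately show ?case using Suc(2)[symmetric] Suc(3)
    by (simp add: move_def ex_Loop_iff ex_basic s'_def)
qed

lemma ex_clear: "ex (clear r) s (s(r := 0))"
proof (induction "s r" arbitrary: s)
  case 0
  then show ?case by (simp add: clear_def ex_basic fun_upd_idem)
next
  case (Suc k)
  then show ?case using Suc(1)[of "s(r := k)"] Suc(2)[symmetric]
    by (simp add: clear_def ex_Loop_iff ex_basic)
qed

lemma ex_loop2:
  "r \<noteq> q \<Longrightarrow> r \<noteq> p \<Longrightarrow> q \<noteq> p \<Longrightarrow>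
    ex (Loop r (Inc q ;; Inc p)) s (s(r := 0, q := s q + s r, p := s p + s r))"
proof (induction "s r" arbitrary: s)
  case 0
  then have "s(r := 0, q := s q + s r, p := s p + s r) = s" by auto
  moreover from 0 have "ex (Loop r (Inc q ;; Inc p)) s s" by (simp add: ex_basic)
  ultimately show ?case by (simp only:)
next
  case (Suc k)
  define s' where "s' = s(r := k, q := Suc (s q), p := Suc (s p))"
  have "ex (Loop r (Inc q ;; Inc p)) s' (s'(r := 0, q := s' q + s' r, p := s' p + s' r))"
    by (intro Suc(1)) (use Suc(2-) in \<open>simp_all add: s'_def\<close>)
  moreover have "s'(r := 0, q := s' q + s' r, p := s' p + s' r)
      = s(r := 0, q := s q + s r, p := s p + s r)"
    using Suc(2-) by (auto simp: s'_def fun_eq_iff)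
  moreover have "ex (Loop r (Inc q ;; Inc p)) s t \<longleftrightarrow> ex (Loop r (Inc q ;; Inc p)) s' t" for t
    using Suc(2)[symmetric] Suc(3-)
    by (simp add: ex_Loop_iff ex_assoc ex_basic s'_def)
  ultimately show ?case by simp
qed

lemmas ex_step1 = ex_basic ex_iff[OF ex_move] ex_seq_iff[OF ex_move] ex_iff[OF ex_clear]
  ex_seq_iff[OF ex_clear] ex_iff[OF ex_loop2] ex_seq_iff[OF ex_loop2]

lemma ex_copy:
  "r \<noteq> q \<Longrightarrow> r \<noteq> RC \<Longrightarrow> q \<noteq> RC \<Longrightarrow> s RC = 0 \<Longrightarrow> ex (copy r q) s (s(q := s q + s r))"
  by (auto simp: copy_def ex_step1 fun_eq_iff)

lemma ex_pair_loop:
  "b \<noteq> RC \<Longrightarrow> b \<noteq> RD \<Longrightarrow> s RD = 0 \<Longrightarrow>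
    ex (Loop b (Inc RC ;; Loop b (Inc RD ;; Inc RC) ;; move RD b)) s
      (s(b := 0, RC := s RC + triangle (s b)))"
proof (induction "s b" arbitrary: s)
  case 0
  then have "s(b := 0, RC := s RC + triangle (s b)) = s" by auto
  moreover from 0 have "ex (Loop b (Inc RC ;; Loop b (Inc RD ;; Inc RC) ;; move RD b)) s s"
    by (simp add: ex_basic)
  ultimately show ?case by (simp only:)
next
  case (Suc k)
  define s' where "s' = s(b := k, RC := s RC + Suc k)"
  let ?L = "Loop b (Inc RC ;; Loop b (Inc RD ;; Inc RC) ;; move RD b)"
  have "ex ?L s' (s'(b := 0, RC := s' RC + triangle (s' b)))"
    by (intro Suc(1)) (use Suc(2-) in \<open>simp_all add: s'_def\<close>)
  moreover have "s'(b := 0, RC := s' RC + triangle (s' b)) = s(b := 0, RC := s RC + triangle (s b))"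
    using Suc(2-) by (auto simp: s'_def fun_eq_iff simp flip: Suc(2))
  moreover have "s(b := 0, RD := 0, RC := Suc (s RC + k), b := k) = s'"
    using Suc(2-) by (auto simp: s'_def fun_eq_iff)
  ultimately show ?case using Suc(2)[symmetric] Suc(3-)
    by (simp add: ex_Loop_iff ex_assoc ex_step1 fun_upd_twist)
qed

lemma ex_pair:
  assumes "v \<noteq> b" "v \<notin> {RC, RD}" "b \<notin> {RC, RD}" "s RC = 0" "s RD = 0"
  shows "ex (pair v b) s (s(v := 0, b := prod_encode (s v, s b)))"
  using assms
  by (auto simp: pair_def ex_step1 ex_seq_iff[OF ex_pair_loop] prod_encode_def fun_eq_iff add_ac)

lemma ex_push:
  assumes "v \<noteq> b" "v \<notin> {RC, RD}" "b \<notin> {RC, RD}" "s RC = 0" "s RD = 0"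
  shows "ex (push v b) s (s(v := 0, b := Suc (prod_encode (s v, s b))))"
  using assms by (simp add: push_def ex_seq_iff[OF ex_pair] ex_step1)

lemma ex_pushcopy:
  assumes "v \<noteq> b" "v \<notin> {RC, RD, RE}" "b \<notin> {RC, RD, RE}" "s RC = 0" "s RD = 0" "s RE = 0"
  shows "ex (pushcopy v b) s (s(b := Suc (prod_encode (s v, s b))))"
  using assms 
  by (auto simp: pushcopy_def ex_seq_iff[OF ex_copy] ex_iff[OF ex_push] fun_eq_iff)

lemma ex_unpair_loop:
  "b \<noteq> RC \<Longrightarrow> v \<noteq> RC \<Longrightarrow> v \<noteq> b \<Longrightarrow>
    ex (Loop RC (Branch b (Inc v) (move v b ;; Inc b))) s
      (s(RC := 0, v := fst (prod_decode (s RC + prod_encode (s v, s b))),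
         b := snd (prod_decode (s RC + prod_encode (s v, s b)))))"
proof (induction "s RC" arbitrary: s)
  case 0
  then have "s(RC := 0, v := fst (prod_decode (s RC + prod_encode (s v, s b))),
         b := snd (prod_decode (s RC + prod_encode (s v, s b)))) = s" by auto
  moreover from 0 have "ex (Loop RC (Branch b (Inc v) (move v b ;; Inc b))) s s" by (simp add: ex_basic)
  ultimately show ?case by (simp only:)
next
  case (Suc k)
  let ?c = "Branch b (Inc v) (move v b ;; Inc b)"
  define s' where "s' = (case s b of Suc j \<Rightarrow> s(RC := k, b := j, v := Suc (s v))
     | 0 \<Rightarrow> s(RC := k, v := 0, b := Suc (s v)))"
  \<comment> \<open>The body moves one place along the enumeration, so the counter plus the code of
    the current pair is invariant.\<close>
  have enc: "prod_encode (s' v, s' b) = Suc (prod_encode (s v, s b))"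
    using Suc(2-) by (auto simp: s'_def prod_encode_def split: nat.split)
  have "s' RC = k" using Suc(2-) by (auto simp: s'_def split: nat.split)
  have "ex ?c (s(RC := k)) s'"
  proof (cases "s b")
    case 0
    then show ?thesis using Suc
      by (intro ex_Branch0) (auto simp: s'_def ex_step1)
  next
    case (Suc j)
    then show ?thesis using \<open>v \<noteq> b\<close> \<open>v \<noteq> RC\<close> \<open>b \<noteq> RC\<close>
      by (intro ex_BranchS[of _ _ j]) (auto simp: s'_def ex_step1)
  qed
  moreover have "ex (Loop RC ?c) s' (s'(RC := 0, v := fst (prod_decode (s' RC + prod_encode (s' v, s' b))),
         b := snd (prod_decode (s' RC + prod_encode (s' v, s' b)))))"
    using Suc(1)[of s'] Suc(3-) \<open>s' RC = k\<close> by simp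
  moreover have "s'(RC := 0, v := fst (prod_decode (s' RC + prod_encode (s' v, s' b))),
         b := snd (prod_decode (s' RC + prod_encode (s' v, s' b)))) =
      s(RC := 0, v := fst (prod_decode (s RC + prod_encode (s v, s b))),
         b := snd (prod_decode (s RC + prod_encode (s v, s b))))"
    unfolding enc \<open>s' RC = k\<close> Suc(2)[symmetric]
    by (auto simp: s'_def fun_eq_iff split: nat.split)
  ultimately show ?case using Suc(2)[symmetric] by (auto intro: ex_LoopS)
qed

lemma ex_pop:
  assumes "v \<noteq> b" "v \<noteq> RC" "b \<noteq> RC" "s RC = 0" "s v = 0"
  shows "ex (pop b v) s (s(v := fst (prod_decode (s b - 1)), b := snd (prod_decode (s b - 1))))"
proof -
  have "ex (Branch b Skip Skip) s (s(b := s b - 1))"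
    by (cases "s b") (auto intro: ex_Branch0 ex_BranchS[OF _ ex_Skip] simp: ex_basic fun_upd_idem)
  moreover have "prod_encode (0, 0) = 0" by (simp add: prod_encode_def)
  ultimately show ?thesis using assms
    by (auto simp: pop_def ex_seq_iff[of "Branch b Skip Skip" s] ex_step1 ex_iff[OF ex_unpair_loop] fun_eq_iff)
qed

lemmas ex_steps = ex_step1
  ex_iff[OF ex_copy] ex_seq_iff[OF ex_copy]
  ex_iff[OF ex_pair] ex_seq_iff[OF ex_pair]
  ex_iff[OF ex_push] ex_seq_iff[OF ex_push]
  ex_iff[OF ex_pushcopy] ex_seq_iff[OF ex_pushcopy]
  ex_iff[OF ex_pop] ex_seq_iff[OF ex_pop]

section \<open>Compiling recursive functions\<close>

fun drops :: "nat \<Rightarrow> cmd" where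
  "drops 0 = Skip"
| "drops (Suc i) = pop RA RX ;; clear RX ;; drops i"

text \<open>On top of the stack lies the code of the list of values found so far; the arguments are
  saved above it while \<open>c\<close> runs. Values are consed in front, hence \<open>args\<close>
  works through the commands from the last to the first.\<close>

definition arg_step :: "cmd \<Rightarrow> cmd" where
  "arg_step c = pushcopy RA RB ;; c ;; pop RB RX ;; pop RB RY ;; push RA RY ;; push RY RB ;; move RX RA"

fun args :: "cmd list \<Rightarrow> cmd" where
  "args [] = Skip"
| "args (c # cs) = args cs ;; arg_step c"

text \<open>\<open>RX\<close> counts the remaining rounds, \<open>RY\<close> the finished ones,
  \<open>RZ\<close> holds the parameters and \<open>RA\<close> the current value. The first three
  survive the call of \<open>c\<close> on the stack.\<close>

definition prim_step :: "cmd \<Rightarrow> cmd" where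
  "prim_step c = pushcopy RZ RB ;; pushcopy RY RB ;; push RX RB ;; push RA RZ ;; push RY RZ ;;
     move RZ RA ;; c ;; pop RB RX ;; pop RB RY ;; pop RB RZ ;; Inc RY"

text \<open>Here \<open>RX\<close> is a flag: the surrounding loop lowers it on entry, and the last
  branch raises it again, with the next candidate in \<open>RY\<close>, if the value was
  nonzero.\<close>

definition min_step :: "cmd \<Rightarrow> cmd" where
  "min_step c = pushcopy RZ RB ;; pushcopy RY RB ;; push RY RZ ;; move RZ RA ;; c ;;
     pop RB RY ;; pop RB RZ ;; Branch RA (clear RA ;; Inc RY ;; Inc RX) Skip"

text \<open>The argument list enters, and the value leaves, in \<open>RA\<close>; \<open>RB\<close> holds a stack,
  coded like the argument list.\<close>
fun compile :: "recf \<Rightarrow> cmd" where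
  "compile Zero = clear RA"
| "compile Succ = pop RA RX ;; clear RA ;; move RX RA ;; Inc RA"
| "compile (Proj i) = drops i ;; pop RA RX ;; clear RA ;; move RX RA"
| "compile (Comp f gs) = push RY RB ;; args (map compile gs) ;; clear RA ;; pop RB RA ;; compile f"
| "compile (PrimRec f g) = pop RA RX ;; push RX RB ;; pushcopy RA RB ;; compile f ;; pop RB RZ ;;
     pop RB RX ;; Loop RX (prim_step (compile g)) ;; clear RY ;; clear RZ"
| "compile (Minim f) = move RA RZ ;; Inc RX ;; Loop RX (min_step (compile f)) ;; move RY RA ;; clear RZ"

section \<open>Correctness of compiled commands\<close>

definition idle :: "(reg \<Rightarrow> nat) \<Rightarrow> bool" where
  "idle s \<longleftrightarrow> s RX = 0 \<and> s RY = 0 \<and> s RZ = 0 \<and> s RC = 0 \<and> s RD = 0 \<and> s RE = 0"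

text \<open>\<open>idle\<close> does not constrain \<open>RB\<close>: any stack is allowed and must
  be restored, so that a caller can keep its data there across nested calls.\<close>

definition computes :: "cmd \<Rightarrow> nat list \<Rightarrow> nat \<Rightarrow> bool" where
  "computes c xs y \<longleftrightarrow> (\<forall>s. idle s \<longrightarrow> s RA = list_encode xs \<longrightarrow> ex c s (s(RA := y)))"

lemma computes_ex: "computes c xs y \<Longrightarrow> idle s \<Longrightarrow> s RA = list_encode xs \<Longrightarrow> ex c s (s(RA := y))"
  by (simp add: computes_def)

lemma ex_drops:
  "i \<le> length xs \<Longrightarrow> s RA = list_encode xs \<Longrightarrow> s RX = 0 \<Longrightarrow> s RC = 0 \<Longrightarrow>
    ex (drops i) s (s(RA := list_encode (drop i xs)))"
proof (induction i arbitrary: s xs)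
  case 0
  then have "s(RA := list_encode xs) = s" by auto
  then show ?case by (simp add: ex_steps)
next
  case (Suc i)
  then obtain x xs' where xs: "xs = x # xs'" by (cases xs) auto
  let ?s = "s(RA := list_encode xs')"
  have "ex (drops i) ?s (?s(RA := list_encode (drop i xs')))"
    by (rule Suc.IH) (use Suc.prems xs in auto)
  moreover have "?s(RX := 0) = ?s" using Suc.prems by auto
  moreover have "ex (drops (Suc i)) s t \<longleftrightarrow> ex (drops i) (?s(RX := 0)) t" for t
    using Suc.prems xs by (simp add: ex_steps fun_upd_twist[of RX RA])
  ultimately show ?case using xs by (simp only: fun_upd_upd drop_Suc_Cons)
qed

lemma ex_arg_step:
  assumes "computes c xs y" "idle s" "s RA = list_encode xs" "s RB = Suc (prod_encode (list_encode ys, b))"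
  shows "ex (arg_step c) s (s(RB := Suc (prod_encode (list_encode (y # ys), b))))"
proof -
  note [simp] = ex_seq_iff[OF computes_ex[OF assms(1)]]
  show ?thesis using assms(2-)
    by (auto simp: arg_step_def ex_steps idle_def fun_eq_iff)
qed

lemma ex_args:
  assumes "list_all2 (\<lambda>c y. computes c xs y) cs ys" "idle s" "s RA = list_encode xs"
    "s RB = Suc (prod_encode (0, b))"
  shows "ex (args cs) s (s(RB := Suc (prod_encode (list_encode ys, b))))"
  using assms(1)
proof (induction rule: list_all2_induct)
  case Nil
  have "s(RB := Suc (prod_encode (list_encode [], b))) = s" using assms(4) by auto
  then show ?case by (simp add: ex_steps)
next
  case (Cons c cs y ys)
  let ?s = "s(RB := Suc (prod_encode (list_encode ys, b)))"
  have "ex (arg_step c) ?s (?s(RB := Suc (prod_encode (list_encode (y # ys), b))))"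
    by (rule ex_arg_step[OF Cons(1)]) (use assms in \<open>auto simp: idle_def\<close>)
  with Cons.IH have "ex (args (c # cs)) s (?s(RB := Suc (prod_encode (list_encode (y # ys), b))))"
    unfolding args.simps by (rule ex_Seq)
  then show ?case by (simp only: fun_upd_upd)
qed

lemma ex_prim_step:
  assumes "computes c (j # y # xs) z" "s RC = 0" "s RD = 0" "s RE = 0"
    "s RY = j" "s RA = y" "s RZ = list_encode xs"
  shows "ex (prim_step c) s (s(RA := z, RY := Suc j))"
proof -
  note [simp] = ex_seq_iff[OF computes_ex[OF assms(1)]]
  show ?thesis using assms(2-)
    by (auto simp: prim_step_def ex_steps idle_def fun_eq_iff)
qed

lemma ex_prim_loop:
  assumes "\<And>i. i < k \<Longrightarrow> computes c ((j + i) # ys i # xs) (ys (Suc i))"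
    "s RC = 0" "s RD = 0" "s RE = 0" "s RY = j" "s RA = ys 0" "s RZ = list_encode xs" "s RX = k"
  shows "ex (Loop RX (prim_step c)) s (s(RX := 0, RA := ys k, RY := j + k))"
  using assms
proof (induction k arbitrary: s j ys)
  case 0
  then have "s(RX := 0, RA := ys 0, RY := j + 0) = s" by auto
  with 0 show ?case by (simp only: ex_iff[OF ex_Loop0])
next
  case (Suc k)
  let ?s = "s(RX := k)" and ?s' = "s(RX := k, RA := ys 1, RY := Suc j)"
  have "ex (prim_step c) ?s (?s(RA := ys 1, RY := Suc j))"
    by (rule ex_prim_step[where y = "ys 0"]) (use Suc.prems Suc.prems(1)[of 0] in auto)
  moreover have "ex (Loop RX (prim_step c)) ?s' (?s'(RX := 0, RA := (\<lambda>i. ys (Suc i)) k, RY := Suc j + k))"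
  proof (rule Suc.IH)
    fix i assume "i < k"
    then show "computes c ((Suc j + i) # ys (Suc i) # xs) (ys (Suc (Suc i)))"
      using Suc.prems(1)[of "Suc i"] by simp
  qed (use Suc.prems in auto)
  moreover have "?s'(RX := 0, RA := (\<lambda>i. ys (Suc i)) k, RY := Suc j + k) = s(RX := 0, RA := ys (Suc k), RY := j + Suc k)"
    by auto
  ultimately show ?case using ex_LoopS[of s RX k] Suc.prems(8) by (simp only:)
qed

inductive_cases reval_ZeroE: "reval Zero xs y"
inductive_cases reval_SuccE: "reval Succ xs y"
inductive_cases reval_ProjE: "reval (Proj i) xs y"
inductive_cases reval_CompE: "reval (Comp f gs) xs y"
inductive_cases reval_Prim0E: "reval (PrimRec f g) (0 # xs) y"
inductive_cases reval_PrimSE: "reval (PrimRec f g) (Suc k # xs) y"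
inductive_cases reval_PrimE: "reval (PrimRec f g) xs y"
inductive_cases reval_MinimE: "reval (Minim f) xs y"

text \<open>Unfolds the recursion into its table of intermediate values, since the compiled loop
  runs it upwards from 0.\<close>

lemma reval_PrimRec_seq:
  assumes "reval (PrimRec f g) (k # xs) y"
  shows "\<exists>ys. reval f xs (ys 0) \<and> (\<forall>i<k. reval g (i # ys i # xs) (ys (Suc i))) \<and> ys k = y"
  using assms
proof (induction k arbitrary: y)
  case 0
  then show ?case by (auto elim: reval_Prim0E)
next
  case (Suc k)
  then obtain z where z: "reval (PrimRec f g) (k # xs) z" "reval g (k # z # xs) y"
    by (auto elim: reval_PrimSE)
  from Suc.IH[OF z(1)] obtain ys where
    ys: "reval f xs (ys 0)" "\<forall>i<k. reval g (i # ys i # xs) (ys (Suc i))" "ys k = z" by blast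
  show ?case
    using ys z by (intro exI[of _ "ys(Suc k := y)"]) (auto simp: less_Suc_eq)
qed

lemma ex_min_step:
  assumes "computes c (k # xs) y" "s RC = 0" "s RD = 0" "s RE = 0" "s RX = 0"
    "s RY = k" "s RA = 0" "s RZ = list_encode xs"
  shows "ex (min_step c) s (if y = 0 then s else s(RY := Suc k, RX := 1))"
proof -
  note [simp] = ex_seq_iff[OF computes_ex[OF assms(1)]]
  have *: "ex (Branch RA (clear RA ;; Inc RY ;; Inc RX) Skip) u t \<longleftrightarrow>
      t = (if u RA = 0 then u else u(RA := 0, RY := Suc (u RY), RX := Suc (u RX)))" for u t
  proof (rule ex_iff, cases "u RA")
    case (Suc j)
    then show "ex (Branch RA (clear RA ;; Inc RY ;; Inc RX) Skip) u
      (if u RA = 0 then u else u(RA := 0, RY := Suc (u RY), RX := Suc (u RX)))"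
      by (intro ex_BranchS[of _ _ j]) (auto simp: ex_steps)
  qed (auto intro!: ex_Branch0 ex_Skip)
  show ?thesis using assms(2-)
    by (auto simp: min_step_def ex_steps idle_def * fun_eq_iff)
qed

lemma ex_min_loop:
  assumes "computes c ((k + d) # xs) 0" "\<And>j. k \<le> j \<Longrightarrow> j < k + d \<Longrightarrow> \<exists>y. computes c (j # xs) (Suc y)"
    "s RC = 0" "s RD = 0" "s RE = 0" "s RX = 1" "s RY = k" "s RA = 0" "s RZ = list_encode xs"
  shows "ex (Loop RX (min_step c)) s (s(RX := 0, RY := k + d))"
  using assms
proof (induction d arbitrary: s k)
  case 0
  let ?s = "s(RX := 0)"
  have "ex (min_step c) ?s (if (0::nat) = 0 then ?s else ?s(RY := Suc k, RX := 1))"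
    by (rule ex_min_step) (use 0 in auto)
  moreover have "s(RX := 0, RY := k + 0) = ?s" using 0 by auto
  moreover have "ex (Loop RX (min_step c)) ?s ?s" by (rule ex_Loop0) simp
  moreover have "s RX = Suc 0" using 0 by simp
  ultimately show ?case using ex_LoopS[of s RX 0] by (simp only: if_True simp_thms)
next
  case (Suc d)
  obtain y where y: "computes c (k # xs) (Suc y)" using Suc.prems(2)[of k] by auto
  let ?s = "s(RX := 0)" and ?s' = "s(RX := 0, RY := Suc k, RX := 1)"
  have "ex (min_step c) ?s (if Suc y = 0 then ?s else ?s(RY := Suc k, RX := 1))"
    by (rule ex_min_step[OF y]) (use Suc.prems in auto)
  moreover have "ex (Loop RX (min_step c)) ?s' (?s'(RX := 0, RY := Suc k + d))"
    by (rule Suc.IH) (use Suc.prems in auto)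
  moreover have "?s'(RX := 0, RY := Suc k + d) = s(RX := 0, RY := k + Suc d)" by auto
  moreover have "s RX = Suc 0" using Suc.prems by simp
  ultimately show ?case using ex_LoopS[of s RX 0 "min_step c" ?s'] by (simp only: if_False nat.simps)
qed

theorem compile_correct: "reval G xs y \<Longrightarrow> computes (compile G) xs y"
proof (induction G arbitrary: xs y)
  case Zero
  then show ?case by (auto simp: computes_def ex_steps elim: reval_ZeroE)
next
  case Succ
  then obtain x xs' where "xs = x # xs'" "y = Suc x" by (auto elim: reval_SuccE)
  then show ?case by (auto simp: computes_def ex_steps idle_def fun_eq_iff)
next
  case (Proj i)
  then have i: "i < length xs" "y = xs ! i" by (auto elim: reval_ProjE)
  then have "drop i xs = y # drop (Suc i) xs" by (simp add: Cons_nth_drop_Suc)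
  then show ?case using i
    by (auto simp: computes_def ex_seq_iff[OF ex_drops[of i xs]] ex_steps idle_def fun_eq_iff)
next
  case (Comp f gs)
  from Comp.prems obtain ys where ys: "list_all2 (\<lambda>g y. reval g xs y) gs ys" "reval f ys y"
    by (auto elim: reval_CompE)
  have all: "list_all2 (\<lambda>c y. computes c xs y) (map compile gs) ys"
    using ys(1) Comp.IH(2) by (auto simp: list_all2_conv_all_nth)
  note [simp] = ex_seq_iff[OF ex_args[OF all]] ex_iff[OF computes_ex[OF Comp.IH(1)[OF ys(2)]]]
  show ?case
    by (auto simp: computes_def idle_def ex_steps fun_eq_iff)
next
  case (PrimRec f g)
  from PrimRec.prems obtain k xs' where xs: "xs = k # xs'" by (auto elim: reval_PrimE)
  from reval_PrimRec_seq[OF PrimRec.prems[unfolded xs]] obtain ys where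
    ys: "reval f xs' (ys 0)" "\<And>i. i < k \<Longrightarrow> reval g (i # ys i # xs') (ys (Suc i))" "ys k = y" by blast
  note [simp] = ex_seq_iff[OF computes_ex[OF PrimRec.IH(1)[OF ys(1)]]]
  have "i < k \<Longrightarrow> computes (compile g) ((0 + i) # ys i # xs') (ys (Suc i))" for i
    using PrimRec.IH(2) ys(2) by simp
  note [simp] = ex_seq_iff[OF ex_prim_loop[where ys = ys, OF this]]
  show ?case
    using ys(3) xs by (auto simp: computes_def idle_def ex_steps fun_eq_iff)
next
  case (Minim f)
  from Minim.prems have y: "reval f (y # xs) 0" "\<forall>j<y. \<exists>z. reval f (j # xs) (Suc z)"
    by (auto elim: reval_MinimE)
  have "computes (compile f) ((0 + y) # xs) 0" using y(1) Minim.IH by simp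
  moreover have "\<exists>z. computes (compile f) (j # xs) (Suc z)" if "j < 0 + y" for j
    using y(2) Minim.IH that by force
  ultimately have loop: "ex (Loop RX (min_step (compile f))) s (s(RX := 0, RY := 0 + y))"
    if "s RC = 0" "s RD = 0" "s RE = 0" "s RX = 1" "s RY = 0" "s RA = 0" "s RZ = list_encode xs" for s
    using that by (intro ex_min_loop) auto
  show ?case
    by (auto simp: computes_def idle_def ex_steps ex_seq_iff[OF loop] fun_eq_iff)
qed

section \<open>Counter machines\<close>

datatype instr = IncI reg nat | DecI reg nat nat | JmpI nat

inductive step :: "instr list \<Rightarrow> nat \<times> (reg \<Rightarrow> nat) \<Rightarrow> nat \<times> (reg \<Rightarrow> nat) \<Rightarrow> bool"
  for P :: "instr list" where
  step_inc: "q < length P \<Longrightarrow> P ! q = IncI r k \<Longrightarrow> step P (q, s) (k, s(r := Suc (s r)))"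
| step_dec: "q < length P \<Longrightarrow> P ! q = DecI r k l \<Longrightarrow> s r = Suc j \<Longrightarrow> step P (q, s) (k, s(r := j))"
| step_zero: "q < length P \<Longrightarrow> P ! q = DecI r k l \<Longrightarrow> s r = 0 \<Longrightarrow> step P (q, s) (l, s)"
| step_jmp: "q < length P \<Longrightarrow> P ! q = JmpI k \<Longrightarrow> step P (q, s) (k, s)"

lemma step_det: "step P a b \<Longrightarrow> step P a c \<Longrightarrow> b = c"
  by (erule step.cases; erule step.cases; auto)

text \<open>A machine accepts by jumping to the address just behind its program and rejects by
  getting stuck elsewhere.\<close>
definition accepts :: "instr list \<Rightarrow> nat \<Rightarrow> (reg \<Rightarrow> nat) \<Rightarrow> bool" where
  "accepts P q s \<longleftrightarrow> (\<exists>t. (step P)\<^sup>*\<^sup>* (q, s) (length P, t))"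

lemma accepts_final: "accepts P (length P) s"
  unfolding accepts_def by blast

text \<open>Steps are deterministic and the accepting address lies outside the program, so an
  accepting run must pass through the given successor. This equivalence is what makes the separating
  functional agree on both sides of an instruction.\<close>

lemma accepts_step:
  assumes "step P (q, s) (q', s')"
  shows "accepts P q s \<longleftrightarrow> accepts P q' s'"
proof
  assume "accepts P q s"
  then obtain t where t: "(step P)\<^sup>*\<^sup>* (q, s) (length P, t)" unfolding accepts_def by blast
  moreover have "q < length P" using assms by (auto elim: step.cases)
  ultimately obtain y where "step P (q, s) y" "(step P)\<^sup>*\<^sup>* y (length P, t)"
    by (metis converse_rtranclpE less_irrefl prod.inject)
  then show "accepts P q' s'" using step_det[OF assms] unfolding accepts_def by blast
next
  assume "accepts P q' s'"
  then show "accepts P q s"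
    using assms unfolding accepts_def by (meson converse_rtranclp_into_rtranclp)
qed

lemma accepts_steps: "(step P)\<^sup>*\<^sup>* (q, s) (q', s') \<Longrightarrow> accepts P q s \<longleftrightarrow> accepts P q' s'"
  by (induction rule: rtranclp_induct2) (auto dest: accepts_step)

section \<open>From commands to counter machine programs\<close>

text \<open>Jump targets are absolute, so the code depends on its load address \<open>p\<close>. The
  \<open>+ 2\<close> skips the test at the front and the jump behind the body.\<close>

fun code :: "nat \<Rightarrow> cmd \<Rightarrow> instr list" where
  "code p Skip = []"
| "code p (Inc r) = [IncI r (Suc p)]"
| "code p (c ;; d) = code p c @ code (p + length (code p c)) d"
| "code p (Loop r c) =
    DecI r (Suc p) (p + length (code (Suc p) c) + 2) # code (Suc p) c @ [JmpI p]"
| "code p (Branch r c d) =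
    (let l = length (code (Suc p) c); D = code (p + l + 2) d
     in DecI r (Suc p) (p + l + 2) # code (Suc p) c @ JmpI (p + l + 2 + length D) # D)"

definition loaded :: "instr list \<Rightarrow> nat \<Rightarrow> instr list \<Rightarrow> bool" where
  "loaded P p L \<longleftrightarrow> (\<exists>pre post. P = pre @ L @ post \<and> length pre = p)"

lemma loaded_append:
  "loaded P p (L @ M) \<Longrightarrow> loaded P p L \<and> loaded P (p + length L) M"
  unfolding loaded_def by (metis append.assoc length_append)

lemma loaded_Cons:
  assumes "loaded P p (i # L)"
  shows "p < length P" "P ! p = i" "loaded P (Suc p) L"
proof -
  from assms obtain pre post where P: "P = pre @ (i # L) @ post" "length pre = p"
    unfolding loaded_def by blast
  then show "p < length P" "P ! p = i" by (auto simp: nth_append)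
  from P have "P = (pre @ [i]) @ L @ post" "length (pre @ [i]) = Suc p" by auto
  then show "loaded P (Suc p) L" unfolding loaded_def by blast
qed

lemma code_steps:
  "ex c s t \<Longrightarrow> loaded P p (code p c) \<Longrightarrow> (step P)\<^sup>*\<^sup>* (p, s) (p + length (code p c), t)"
proof (induction arbitrary: p rule: ex.induct)
  case (ex_Skip s)
  then show ?case by simp
next
  case (ex_Inc r s)
  then have "step P (p, s) (Suc p, s(r := Suc (s r)))"
    by (intro step_inc) (auto dest: loaded_Cons)
  moreover have "p + length (code p (Inc r)) = Suc p" by simp
  ultimately show ?case by (simp only: r_into_rtranclp)
next
  case (ex_Seq c s t d u)
  from loaded_append[OF ex_Seq.prems[simplified]]
  have "(step P)\<^sup>*\<^sup>* (p, s) (p + length (code p c), t)"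
    "(step P)\<^sup>*\<^sup>* (p + length (code p c), t) (p + length (code p c) + length (code (p + length (code p c)) d), u)"
    using ex_Seq.IH by auto
  then show ?case by (simp add: add.assoc)
next
  case (ex_Loop0 s r c)
  then have "step P (p, s) (p + length (code (Suc p) c) + 2, s)"
    using loaded_Cons[of P p] by (intro step_zero) auto
  then show ?case by auto
next
  case (ex_LoopS s r k c t u)
  let ?e = "Suc p + length (code (Suc p) c)"
  note l = loaded_Cons[OF ex_LoopS.prems[simplified]]
  note l' = loaded_append[OF l(3)]
  have "step P (p, s) (Suc p, s(r := k))"
    using l ex_LoopS.hyps by (intro step_dec) auto
  moreover have "(step P)\<^sup>*\<^sup>* (Suc p, s(r := k)) (?e, t)"
    using l' ex_LoopS.IH(1) by blast
  moreover have "step P (?e, t) (p, t)"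
    using l' by (intro step_jmp) (auto dest: loaded_Cons)
  moreover have "(step P)\<^sup>*\<^sup>* (p, t) (p + length (code p (Loop r c)), u)"
    by (rule ex_LoopS.IH(2)[OF ex_LoopS.prems])
  ultimately show ?case
    by (meson converse_rtranclp_into_rtranclp rtranclp_trans)
next
  case (ex_Branch0 s r d t c)
  let ?l = "p + length (code (Suc p) c) + 2"
  note l = loaded_Cons[OF ex_Branch0.prems[simplified Let_def code.simps]]
  have "loaded P ?l (code ?l d)"
    using loaded_append[OF l(3)] loaded_Cons(3) by fastforce
  then have "(step P)\<^sup>*\<^sup>* (?l, s) (?l + length (code ?l d), t)" by (rule ex_Branch0.IH)
  moreover have "step P (p, s) (?l, s)"
    using l ex_Branch0.hyps by (intro step_zero) auto
  ultimately show ?case by (simp add: Let_def add.assoc)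
next
  case (ex_BranchS s r k c t d)
  let ?l = "p + length (code (Suc p) c) + 2"
  note l = loaded_Cons[OF ex_BranchS.prems[simplified Let_def code.simps]]
  note l' = loaded_append[OF l(3)]
  have "step P (p, s) (Suc p, s(r := k))"
    using l ex_BranchS.hyps by (intro step_dec) auto
  moreover have "(step P)\<^sup>*\<^sup>* (Suc p, s(r := k)) (Suc p + length (code (Suc p) c), t)"
    using l' ex_BranchS.IH by blast
  moreover have "step P (Suc p + length (code (Suc p) c), t) (?l + length (code ?l d), t)"
    using l' by (intro step_jmp) (auto dest: loaded_Cons)
  ultimately have "(step P)\<^sup>*\<^sup>* (p, s) (?l + length (code ?l d), t)"
    by (meson converse_rtranclp_into_rtranclp rtranclp.rtrancl_into_rtrancl)
  then show ?case by (simp add: Let_def add.assoc)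
qed

text \<open>The final test goes to \<open>l + 1\<close>, the accepting address just behind the
  program, if the result is zero, and otherwise to \<open>l + 2\<close>, where the machine is
  stuck.\<close>

definition machine :: "cmd \<Rightarrow> instr list" where
  "machine c = (let l = length (code 0 c) in code 0 c @ [DecI RA (l + 2) (l + 1)])"

lemma accepts_machine:
  assumes "ex c s t"
  shows "accepts (machine c) 0 s \<longleftrightarrow> t RA = 0"
proof -
  let ?P = "machine c" and ?l = "length (code 0 c)"
  have len: "length ?P = ?l + 1" and nth: "?P ! ?l = DecI RA (?l + 2) (?l + 1)"
    by (simp_all add: machine_def Let_def nth_append)
  have "loaded ?P 0 (code 0 c)" unfolding loaded_def machine_def by (auto simp: Let_def)
  from code_steps[OF assms this] have 1: "accepts ?P 0 s \<longleftrightarrow> accepts ?P ?l t"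
    by (intro accepts_steps) simp
  show ?thesis
  proof (cases "t RA")
    case 0
    then have "step ?P (?l, t) (?l + 1, t)" using len nth by (intro step_zero) auto
    with 1 0 len show ?thesis using accepts_step accepts_final by metis
  next
    case (Suc j)
    then have "step ?P (?l, t) (?l + 2, t(RA := j))" using len nth by (intro step_dec) auto
    moreover have "\<not> accepts ?P (?l + 2) u" for u
    proof
      assume "accepts ?P (?l + 2) u"
      then obtain v where "(step ?P)\<^sup>*\<^sup>* (?l + 2, u) (?l + 1, v)"
        unfolding accepts_def len by blast
      then show False
        by (rule converse_rtranclpE) (auto elim!: step.cases simp: len)
    qed
    ultimately show ?thesis using 1 Suc accepts_step by auto
  qed
qed

section \<open>Linear functionals on differential polynomials\<close>

text \<open>Used at two levels: it extends a function on monomials linearly to polynomials, and,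
  since a monomial is itself a finitely supported map into \<open>nat\<close>, it sums weights of
  variables over a monomial.\<close>

definition lin :: "('k \<Rightarrow> 'b) \<Rightarrow> ('k \<Rightarrow>\<^sub>0 'b) \<Rightarrow> 'b::comm_semiring_1" where
  "lin g p = (\<Sum>k\<in>Poly_Mapping.keys p. Poly_Mapping.lookup p k * g k)"

lemma lin_superset:
  "finite K \<Longrightarrow> Poly_Mapping.keys p \<subseteq> K \<Longrightarrow> lin g p = (\<Sum>k\<in>K. Poly_Mapping.lookup p k * g k)"
  unfolding lin_def by (intro sum.mono_neutral_left) (auto simp: in_keys_iff)

lemma lin_zero [simp]: "lin g 0 = 0"
  by (simp add: lin_def)

lemma lin_single [simp]: "lin g (Poly_Mapping.single k c) = c * g k"
  by (subst lin_superset[of "{k}"]) auto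

lemma lin_add [simp]: "lin g (p + q) = lin g p + lin g q"
proof -
  let ?K = "Poly_Mapping.keys p \<union> Poly_Mapping.keys q"
  have "Poly_Mapping.keys (p + q) \<subseteq> ?K" by (rule Poly_Mapping.keys_add)
  then show ?thesis
    by (simp add: lin_superset[of ?K] lookup_add distrib_right sum.distrib)
qed

lemma lin_sum: "lin g (\<Sum>i\<in>I. f i) = (\<Sum>i\<in>I. lin g (f i))"
  by (induction I rule: infinite_finite_induct) auto

lemma lin_zero_fun [simp]: "lin (\<lambda>_. 0) p = 0"
  by (simp add: lin_def)

lemma lin_add_fun: "lin (\<lambda>k. g k + h k) p = lin g p + lin h p"
  by (simp add: lin_def distrib_left sum.distrib)

lemma lin_cmult_fun: "lin (\<lambda>k. c * g k) p = c * lin g p"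
  by (simp add: lin_def sum_distrib_left mult_ac)

lemma lin_sum_fun: "lin (\<lambda>k. \<Sum>i\<in>I. g i k) p = (\<Sum>i\<in>I. lin (g i) p)"
  by (induction I rule: infinite_finite_induct) (auto simp: lin_add_fun)

lemma lin_swap: "lin (\<lambda>a. lin (h a) q) p = lin (\<lambda>b. lin (\<lambda>a. h a b) p) q"
  unfolding lin_def sum_distrib_left by (subst sum.swap) (simp add: mult_ac)

lemma sum_monomials:
  "(\<Sum>k\<in>Poly_Mapping.keys p. Poly_Mapping.single k (Poly_Mapping.lookup p k)) = p"
  by (rule poly_mapping_eqI) (auto simp: lookup_sum lookup_single when_def in_keys_iff)

lemma times_monomials:
  fixes p q :: "('k::monoid_add \<Rightarrow>\<^sub>0 'b::comm_semiring_1)"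
  shows "p * q = (\<Sum>a\<in>Poly_Mapping.keys p. \<Sum>b\<in>Poly_Mapping.keys q.
    Poly_Mapping.single a (Poly_Mapping.lookup p a) * Poly_Mapping.single b (Poly_Mapping.lookup q b))"
  by (simp only: sum_monomials flip: sum_product)

lemma lin_times: "lin g (p * q) = lin (\<lambda>a. lin (\<lambda>b. g (a + b)) q) p"
  by (subst times_monomials) (simp add: lin_sum mult_single lin_def[of _ p] lin_def[of _ q] sum_distrib_left mult.assoc)

section \<open>The Leibniz rule for derivations\<close>

text \<open>One term of the Leibniz rule: a factor \<open>v\<close> of the monomial is replaced by
  its derivative. Subtraction is truncated, so this is meaningful only if \<open>v\<close> occurs in
  \<open>c\<close>; otherwise its coefficient in the rule is zero.\<close>

definition replace_deriv :: "nat \<Rightarrow> dvar \<Rightarrow> (dvar \<Rightarrow>\<^sub>0 nat) \<Rightarrow> (dvar \<Rightarrow>\<^sub>0 nat)" where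
  "replace_deriv l v c = c - Poly_Mapping.single v 1 + Poly_Mapping.single (dshift l v) 1"

lemma minus_single_add:
  fixes a b :: "'k \<Rightarrow>\<^sub>0 nat"
  assumes "v \<in> Poly_Mapping.keys a"
  shows "a - Poly_Mapping.single v 1 + b = a + b - Poly_Mapping.single v 1"
  using assms by (intro poly_mapping_eqI) (auto simp: lookup_add lookup_minus lookup_single when_def in_keys_iff)

lemma minus_single_cancel:
  fixes a :: "'k \<Rightarrow>\<^sub>0 nat"
  assumes "v \<in> Poly_Mapping.keys a"
  shows "a - Poly_Mapping.single v 1 + Poly_Mapping.single v 1 = a"
  using assms by (intro poly_mapping_eqI) (auto simp: lookup_add lookup_minus lookup_single when_def in_keys_iff)

lemma replace_deriv_add:
  "v \<in> Poly_Mapping.keys a \<Longrightarrow> replace_deriv l v (a + b) = replace_deriv l v a + b"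
  unfolding replace_deriv_def by (simp only: minus_single_add[symmetric] add_ac)

lemma lin_replace_deriv:
  assumes "v \<in> Poly_Mapping.keys c"
  shows "lin w (replace_deriv l v c) + w v = lin w c + w (dshift l v)"
proof -
  have "lin w (replace_deriv l v c) + w v
      = lin w (c - Poly_Mapping.single v 1 + Poly_Mapping.single v 1) + w (dshift l v)"
    unfolding replace_deriv_def lin_add lin_single by (simp only: mult_1 add_ac)
  then show ?thesis by (simp only: minus_single_cancel[OF assms])
qed

lemma dderiv_monom_eq:
  "dderiv_monom l c x = (\<Sum>v\<in>Poly_Mapping.keys c.
     Poly_Mapping.single (replace_deriv l v c) (x * of_nat (Poly_Mapping.lookup c v)))"
  by (simp add: dderiv_monom_def dmonom_def dX_def mult_single replace_deriv_def)

lemma dderiv_monom_superset: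
  "finite K \<Longrightarrow> Poly_Mapping.keys c \<subseteq> K \<Longrightarrow> dderiv_monom l c x = (\<Sum>v\<in>K.
     Poly_Mapping.single (replace_deriv l v c) (x * of_nat (Poly_Mapping.lookup c v)))"
  unfolding dderiv_monom_eq by (intro sum.mono_neutral_left) (auto simp: in_keys_iff)

lemma dderiv_monom_zero [simp]: "dderiv_monom l c 0 = 0"
  by (simp add: dderiv_monom_eq)

lemma dderiv_monom_add: "dderiv_monom l c (x + y) = dderiv_monom l c x + dderiv_monom l c y"
  by (simp add: dderiv_monom_eq distrib_right single_add sum.distrib)

lemma dderiv_superset:
  "finite K \<Longrightarrow> Poly_Mapping.keys p \<subseteq> K \<Longrightarrow>
    dderiv l p = (\<Sum>c\<in>K. dderiv_monom l c (Poly_Mapping.lookup p c))"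
  unfolding dderiv_def by (intro sum.mono_neutral_left) (auto simp: in_keys_iff)

lemma dderiv_add: "dderiv l (p + q) = dderiv l p + dderiv l q"
proof -
  let ?K = "Poly_Mapping.keys p \<union> Poly_Mapping.keys q"
  have "Poly_Mapping.keys (p + q) \<subseteq> ?K" by (rule Poly_Mapping.keys_add)
  then show ?thesis
    by (simp add: dderiv_superset[of ?K] lookup_add dderiv_monom_add sum.distrib)
qed

lemma dderiv_zero [simp]: "dderiv l 0 = 0"
  by (simp add: dderiv_def)

lemma dderiv_sum: "dderiv l (\<Sum>i\<in>I. f i) = (\<Sum>i\<in>I. dderiv l (f i))"
  by (induction I rule: infinite_finite_induct) (auto simp: dderiv_add)

lemma dderiv_single: "dderiv l (Poly_Mapping.single c x) = dderiv_monom l c x"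
  by (subst dderiv_superset[of "{c}"]) auto

lemma dderiv_dX: "dderiv l (dX v) = dX (dshift l v)"
  by (simp add: dX_def dderiv_single dderiv_monom_eq replace_deriv_def)

lemma dderiv_uminus: "dderiv l (- p) = - dderiv l p"
  by (metis add.right_inverse add_eq_0_iff dderiv_add dderiv_zero)

lemma dderiv_diff: "dderiv l (p - q) = dderiv l p - dderiv l q"
  using dderiv_add[of l p "- q"] by (simp add: dderiv_uminus)

lemma dderiv_monom_times:
  "dderiv_monom l (a + b) (x * y) =
    dderiv_monom l a x * Poly_Mapping.single b y + Poly_Mapping.single a x * dderiv_monom l b y"
proof -
  define K where "K = Poly_Mapping.keys a \<union> Poly_Mapping.keys b"
  have K: "finite K" "Poly_Mapping.keys (a + b) \<subseteq> K"
    unfolding K_def by (auto dest: subsetD[OF Poly_Mapping.keys_add])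
  have part: "dderiv_monom l a x * Poly_Mapping.single b y = (\<Sum>v\<in>K.
      Poly_Mapping.single (replace_deriv l v (a + b)) (x * y * of_nat (Poly_Mapping.lookup a v)))"
    if "Poly_Mapping.keys a \<subseteq> K" for a b x y
  proof -
    have "dderiv_monom l a x * Poly_Mapping.single b y = (\<Sum>v\<in>Poly_Mapping.keys a.
        Poly_Mapping.single (replace_deriv l v (a + b)) (x * y * of_nat (Poly_Mapping.lookup a v)))"
      by (simp add: dderiv_monom_eq sum_distrib_right mult_single replace_deriv_add mult.assoc mult.commute[of y])
    also have "\<dots> = (\<Sum>v\<in>K.
        Poly_Mapping.single (replace_deriv l v (a + b)) (x * y * of_nat (Poly_Mapping.lookup a v)))"
      using that K(1) by (intro sum.mono_neutral_left) (auto simp: in_keys_iff)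
    finally show ?thesis .
  qed
  have "dderiv_monom l (a + b) (x * y) =
      dderiv_monom l a x * Poly_Mapping.single b y + dderiv_monom l b y * Poly_Mapping.single a x"
    by (subst (1 2) part)
      (auto simp: K_def dderiv_monom_superset[OF K] lookup_add distrib_left single_add
        sum.distrib[symmetric] K_def add.commute mult.commute intro!: sum.cong)
  then show ?thesis by (simp add: mult.commute)
qed

lemma dderiv_times: "dderiv l (p * q) = dderiv l p * q + p * dderiv l q"
proof -
  let ?s = "\<lambda>r k. Poly_Mapping.single k (Poly_Mapping.lookup r k)"
  have "dderiv l (p * q) = (\<Sum>a\<in>Poly_Mapping.keys p. \<Sum>b\<in>Poly_Mapping.keys q. dderiv l (?s p a * ?s q b))"
    by (subst times_monomials) (simp add: dderiv_sum)
  also have "\<dots> = (\<Sum>a\<in>Poly_Mapping.keys p. \<Sum>b\<in>Poly_Mapping.keys q.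
      dderiv l (?s p a) * ?s q b + ?s p a * dderiv l (?s q b))"
    by (simp add: mult_single dderiv_single dderiv_monom_times)
  also have "\<dots> = (\<Sum>a\<in>Poly_Mapping.keys p. dderiv l (?s p a)) * (\<Sum>b\<in>Poly_Mapping.keys q. ?s q b)
      + (\<Sum>a\<in>Poly_Mapping.keys p. ?s p a) * (\<Sum>b\<in>Poly_Mapping.keys q. dderiv l (?s q b))"
    by (simp add: sum.distrib sum_product)
  also have "\<dots> = dderiv l p * q + p * dderiv l q"
    by (simp add: sum_monomials flip: dderiv_sum)
  finally show ?thesis .
qed

lemma lin_dderiv:
  "lin g (dderiv l p) =
    lin (\<lambda>a. \<Sum>v\<in>Poly_Mapping.keys a. of_nat (Poly_Mapping.lookup a v) * g (replace_deriv l v a)) p"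
  by (simp add: dderiv_def dderiv_monom_eq lin_sum lin_def[of _ p] sum_distrib_left mult.assoc)

text \<open>\<open>T\<close> is a degree, and \<open>g\<close> a functional concentrated in degree one that kills all derivatives.
  Polynomials on which every shift of \<open>g\<close> by a monomial of degree zero vanishes then form a
  differential subalgebra.\<close>
lemma lin_dsubalg_zero:
  fixes g :: "(dvar \<Rightarrow>\<^sub>0 nat) \<Rightarrow> 'a::comm_ring_1"
  assumes deg: "\<And>a. g a \<noteq> 0 \<Longrightarrow> lin T a = 1"
    and shift: "\<And>l v. l < m \<Longrightarrow> T (dshift l v) = 0"
    and kill: "\<And>l c. l < m \<Longrightarrow>
      (\<Sum>v\<in>Poly_Mapping.keys c. of_nat (Poly_Mapping.lookup c v) * g (replace_deriv l v c)) = 0"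
    and gens: "\<And>s u. s \<in> S \<Longrightarrow> lin T u = 0 \<Longrightarrow> lin (\<lambda>a. g (u + a)) s = 0"
    and p: "p \<in> dsubalg m S"
  shows "lin T u = 0 \<Longrightarrow> lin (\<lambda>a. g (u + a)) p = 0"
  using p
proof (induction arbitrary: u rule: dsubalg.induct)
  case (gen s)
  then show ?case using gens by blast
next
  case (const c)
  then have "g u = 0" using deg[of u] by fastforce
  then show ?case by (simp add: dconst_def)
next
  case (add p q)
  then show ?case by simp
next
  case (mult p q)
  let ?h = "\<lambda>a b. g (u + (a + b))"
  \<comment> \<open>Degrees are natural numbers and \<open>u\<close> has degree 0, so where
    \<open>?h a b\<close> is nonzero exactly one of \<open>a\<close> and \<open>b\<close> has degree
    0.\<close>
  have "?h a b = (if lin T a = 0 then ?h a b else 0) + (if lin T b = 0 then ?h a b else 0)" for a b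
    using deg[of "u + (a + b)"] mult.prems by (cases "?h a b = 0") auto
  then have "lin (\<lambda>c. g (u + c)) (p * q) =
      lin (\<lambda>a. lin (\<lambda>b. (if lin T a = 0 then ?h a b else 0) + (if lin T b = 0 then ?h a b else 0)) q) p"
    unfolding lin_times by presburger
  also have "\<dots> = lin (\<lambda>a. lin (\<lambda>b. if lin T a = 0 then ?h a b else 0) q) p
      + lin (\<lambda>b. lin (\<lambda>a. if lin T b = 0 then ?h a b else 0) p) q"
    by (simp only: lin_add_fun lin_swap[of "\<lambda>a b. if lin T b = 0 then ?h a b else 0"])
  finally have *: "lin (\<lambda>c. g (u + c)) (p * q) = lin (\<lambda>a. lin (\<lambda>b. if lin T a = 0 then ?h a b else 0) q) p
      + lin (\<lambda>b. lin (\<lambda>a. if lin T b = 0 then ?h a b else 0) p) q" .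
  have "lin (\<lambda>b. if lin T a = 0 then ?h a b else 0) q = 0" for a
    using mult.IH(2)[of "u + a"] mult.prems by (cases "lin T a = 0") (simp_all add: add.assoc)
  moreover have "lin (\<lambda>a. if lin T b = 0 then ?h a b else 0) p = 0" for b
    using mult.IH(1)[of "u + b"] mult.prems by (cases "lin T b = 0") (simp_all add: add_ac)
  ultimately show ?case unfolding * by simp
next
  case (deriv l p)
  let ?c = "\<lambda>a v. of_nat (Poly_Mapping.lookup a v) :: 'a"
  \<comment> \<open>Integration by parts: as \<open>g\<close> kills the derivative of
    \<open>u + a\<close>, the derivation can be moved from \<open>a\<close> to \<open>u\<close> at
    the cost of a sign.\<close>
  have "(\<Sum>v\<in>Poly_Mapping.keys a. ?c a v * g (u + replace_deriv l v a))
      = - (\<Sum>v\<in>Poly_Mapping.keys u. ?c u v * g (replace_deriv l v u + a))" for a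
  proof -
    let ?K = "Poly_Mapping.keys u \<union> Poly_Mapping.keys a"
    have "0 = (\<Sum>v\<in>?K. ?c (u + a) v * g (replace_deriv l v (u + a)))"
      unfolding kill[OF deriv.hyps(1), of "u + a", symmetric]
      by (intro sum.mono_neutral_left) (auto simp: in_keys_iff lookup_add)
    also have "\<dots> = (\<Sum>v\<in>?K. ?c u v * g (replace_deriv l v (u + a)))
        + (\<Sum>v\<in>?K. ?c a v * g (replace_deriv l v (u + a)))"
      by (simp add: lookup_add distrib_right sum.distrib)
    also have "(\<Sum>v\<in>?K. ?c u v * g (replace_deriv l v (u + a)))
        = (\<Sum>v\<in>Poly_Mapping.keys u. ?c u v * g (replace_deriv l v u + a))"
      by (rule sum.mono_neutral_cong_right) (auto simp: in_keys_iff replace_deriv_add)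
    also have "(\<Sum>v\<in>?K. ?c a v * g (replace_deriv l v (u + a)))
        = (\<Sum>v\<in>Poly_Mapping.keys a. ?c a v * g (u + replace_deriv l v a))"
      by (rule sum.mono_neutral_cong_right)
        (auto simp: in_keys_iff replace_deriv_add add.commute[of u])
    finally show ?thesis by (simp add: eq_neg_iff_add_eq_0 add.commute)
  qed
  then have "lin (\<lambda>a. g (u + a)) (dderiv l p)
      = lin (\<lambda>a. \<Sum>v\<in>Poly_Mapping.keys u. - ?c u v * g (replace_deriv l v u + a)) p"
    by (simp add: lin_dderiv sum_negf)
  also have "\<dots> = (\<Sum>v\<in>Poly_Mapping.keys u. - ?c u v * lin (\<lambda>a. g (replace_deriv l v u + a)) p)"
    by (simp only: lin_sum_fun lin_cmult_fun)
  also have "\<dots> = 0"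
  proof (rule sum.neutral, rule ballI)
    fix v assume v: "v \<in> Poly_Mapping.keys u"
    \<comment> \<open>Derived variables have degree 0, so the new shift still has degree 0 and the
      induction hypothesis applies.\<close>
    have "lin T (replace_deriv l v u) = 0"
      using lin_replace_deriv[OF v, of T l] shift[OF deriv.hyps(1), of v] deriv.prems by simp
    from deriv.IH[OF this] show "- ?c u v * lin (\<lambda>a. g (replace_deriv l v u + a)) p = 0" by simp
  qed
  finally show ?case .
qed

section \<open>Machines as generators\<close>

fun idx :: "reg \<Rightarrow> nat" where
  "idx RA = 0" | "idx RB = 1" | "idx RX = 2" | "idx RY = 3"
| "idx RZ = 4" | "idx RC = 5" | "idx RD = 6" | "idx RE = 7"

definition regs :: "reg list" where "regs = [RA, RB, RX, RY, RZ, RC, RD, RE]"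

lemma set_regs: "set regs = UNIV"
  unfolding regs_def using reg.exhaust by auto

lemma distinct_regs: "distinct regs"
  by (simp add: regs_def)

lemma finite_UNIV_reg [simp]: "finite (UNIV :: reg set)"
  unfolding set_regs[symmetric] by simp

lemma idx_inject [simp]: "idx r = idx r' \<longleftrightarrow> r = r'"
  by (cases r; cases r'; simp)

lemma idx_less: "idx r < 8"
  by (cases r) auto

definition fv :: "reg \<Rightarrow> nat" where "fv r = 3 + 2 * idx r"
definition xv :: "reg \<Rightarrow> nat" where "xv r = 4 + 2 * idx r"

lemma fv_xv [simp]:
  "fv r = fv r' \<longleftrightarrow> r = r'" "xv r = xv r' \<longleftrightarrow> r = r'" "fv r \<noteq> xv r'" "xv r \<noteq> fv r'"
  unfolding fv_def xv_def by (simp_all, presburger+)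

lemma fv_xv_bounds [simp]: "2 < fv r" "2 < xv r" "fv r < 19" "xv r < 19" "0 < fv r" "0 < xv r"
  using idx_less[of r] by (auto simp: fv_def xv_def)

lemma fv_xv_neq [simp]:
  "fv r \<noteq> 0" "0 \<noteq> fv r" "xv r \<noteq> 0" "0 \<noteq> xv r"
  "fv r \<noteq> Suc 0" "Suc 0 \<noteq> fv r" "xv r \<noteq> Suc 0" "Suc 0 \<noteq> xv r"
  "fv r \<noteq> 2" "2 \<noteq> fv r" "xv r \<noteq> 2" "2 \<noteq> xv r"
  "fv r \<notin> range xv" "0 \<notin> range xv" "Suc 0 \<notin> range xv" "2 \<notin> range xv"
  by (auto simp: fv_def xv_def, presburger+)

text \<open>The variables are \<open>t\<close> (index 0), \<open>z\<close> and \<open>w\<close> (1 and 2), and \<open>f\<^sub>r\<close>, \<open>x\<^sub>r\<close> for every register \<open>r\<close>.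
  A state \<open>q\<close> is written \<open>z\<^sup>q w\<^sup>N\<^sup>-\<^sup>q\<close>, and a register \<open>r\<close> with content \<open>s\<close> is written
  \<open>x\<^sub>r f\<^sub>r\<^sup>(\<^sup>s\<^sup>)\<close>, where the derivation is \<open>\<delta>\<^sub>0\<close>.\<close>
definition dfac :: "nat \<Rightarrow> nat \<Rightarrow> nat \<Rightarrow> nat \<Rightarrow> dfactor" where
  "dfac m i l k = (i, (replicate m 0)[l := k], 1)"

definition state_facs :: "nat \<Rightarrow> nat \<Rightarrow> nat \<Rightarrow> dfactor list" where
  "state_facs m N q = [(0, replicate m 0, 1), (1, replicate m 0, q), (2, replicate m 0, N - q)]"

definition config_facs :: "nat \<Rightarrow> nat \<Rightarrow> (reg \<Rightarrow> nat) \<Rightarrow> dfactor list" where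
  "config_facs m N s =
     concat (map (\<lambda>r. [dfac m (fv r) 0 (s r), dfac m (xv r) 0 0]) regs) @ state_facs m N 0"

definition config_desc :: "nat \<Rightarrow> nat \<Rightarrow> (reg \<Rightarrow> nat) \<Rightarrow> ddesc" where
  "config_desc m N s = [(1, config_facs m N s)]"

definition rule_desc :: "nat \<Rightarrow> nat \<Rightarrow> nat \<Rightarrow> dfactor list \<Rightarrow> nat \<Rightarrow> dfactor list \<Rightarrow> ddesc" where
  "rule_desc m N q fs k fs' = [(1, fs @ state_facs m N q), (-1, fs' @ state_facs m N k)]"

text \<open>Increment and decrement are stated only for the contents 0 and 1; differentiation
  supplies the rest. The zero test must not spread in this way, and its factor \<open>x_r\<close>
  prevents that, because a derivation acts on \<open>x_r\<close> as well as on
  \<open>f_r\<close>.\<close>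

fun instr_descs :: "nat \<Rightarrow> nat \<Rightarrow> nat \<Rightarrow> instr \<Rightarrow> ddesc list" where
  "instr_descs m N q (IncI r k) = [rule_desc m N q [dfac m (fv r) 0 0] k [dfac m (fv r) 0 1]]"
| "instr_descs m N q (DecI r k l) =
    [rule_desc m N q [dfac m (fv r) 0 1] k [dfac m (fv r) 0 0],
     rule_desc m N q [dfac m (xv r) 0 0, dfac m (fv r) 0 0] l [dfac m (xv r) 0 0, dfac m (fv r) 0 0]]"
| "instr_descs m N q (JmpI k) = [rule_desc m N q [] k []]"

fun targets :: "instr \<Rightarrow> nat" where
  "targets (IncI r k) = k"
| "targets (DecI r k l) = k + l"
| "targets (JmpI k) = k"

text \<open>A crude bound for all addresses that are written as states, so that the exponent N - q
  is never truncated.\<close>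

definition state_bound :: "instr list \<Rightarrow> nat" where
  "state_bound P = length P + sum_list (map targets P)"

text \<open>There are 19 = 3 + 2 * 8 differential variables: \<open>t\<close>, \<open>z\<close>,
  \<open>w\<close> and two for each register. The first list omits index 0, which is
  \<open>t\<close>.\<close>

definition gen_descs :: "nat \<Rightarrow> instr list \<Rightarrow> ddesc list" where
  "gen_descs m P =
     map (\<lambda>i. [(1, [dfac m i 0 0])]) [1..<19] @
     map (\<lambda>l. [(1, [dfac m 0 l 1])]) [0..<m] @
     map (\<lambda>l. [(1, [dfac m 0 0 0, dfac m 1 l 1])]) [0..<m] @
     map (\<lambda>l. [(1, [dfac m 0 0 0, dfac m 2 l 1])]) [0..<m] @
     [[(1, state_facs m (state_bound P) (length P))]] @
     concat (map (\<lambda>q. instr_descs m (state_bound P) q (P ! q)) [0..<length P])"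

lemma targets_le: "q < length P \<Longrightarrow> targets (P ! q) \<le> state_bound P"
  unfolding state_bound_def by (rule trans_le_add2, rule member_le_sum_list) auto

lemma length_le_bound: "length P \<le> state_bound P"
  by (simp add: state_bound_def)

lemma theta_of_single: "l < m \<Longrightarrow> theta_of ((replicate m 0)[l := k]) = Poly_Mapping.single l k"
proof -
  assume l: "l < m"
  have "theta_of ((replicate m 0)[l := k]) =
      (\<Sum>i<m. if i = l then Poly_Mapping.single l k else 0)"
    unfolding theta_of_def by (intro sum.cong) (auto simp: nth_list_update)
  then show ?thesis using l by simp
qed

lemma theta_of_zeros [simp]: "theta_of (replicate m 0) = 0"
  by (simp add: theta_of_def)

section \<open>Evaluating functionals and weights on descriptions\<close>

definition mono_of :: "dfactor list \<Rightarrow> (dvar \<Rightarrow>\<^sub>0 nat)" where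
  "mono_of fs = sum_list (map (\<lambda>(i, js, e). Poly_Mapping.single (i, theta_of js) e) fs)"

lemma dX_power: "dX v ^ e = Poly_Mapping.single (Poly_Mapping.single v e) 1"
proof (induction e)
  case (Suc e)
  then show ?case by (simp add: dX_def mult_single flip: single_add)
qed simp

lemma interp_factors:
  "prod_list (map interp_factor fs) = Poly_Mapping.single (mono_of fs) 1"
  by (induction fs) (auto simp: mono_of_def interp_factor_def dX_power mult_single)

lemma lin_dconst_times: "lin g (dconst x * Poly_Mapping.single k 1) = x * g k"
  unfolding dconst_def mult_single by (simp only: lin_single mult_1_right add_0)

lemma lin_interp: "lin g (interp d) = (\<Sum>(c, fs)\<leftarrow>d. of_int c * g (mono_of fs))"
  by (induction d) (auto simp: interp_def interp_term_def interp_factors lin_dconst_times)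

lemma lin_mono_of: "lin w (mono_of fs) = (\<Sum>(i, js, e)\<leftarrow>fs. e * w (i, theta_of js))"
  by (induction fs) (auto simp: mono_of_def)

lemma lin_mono_of_Nil [simp]: "lin w (mono_of []) = 0"
  by (simp add: lin_mono_of)

lemma lin_mono_of_append [simp]: "lin w (mono_of (fs @ gs)) = lin w (mono_of fs) + lin w (mono_of gs)"
  by (simp add: lin_mono_of)

lemma lin_mono_of_dfac [simp]:
  "l < m \<Longrightarrow> lin w (mono_of (dfac m i l k # fs)) = w (i, Poly_Mapping.single l k) + lin w (mono_of fs)"
  by (simp add: lin_mono_of dfac_def theta_of_single)

lemma lin_mono_of_state [simp]:
  "lin w (mono_of (state_facs m N q)) = w (0, 0) + q * w (1, 0) + (N - q) * w (2, 0)"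
  by (simp add: lin_mono_of state_facs_def)

section \<open>A functional that separates non-accepting configurations\<close>

text \<open>Summed over a monomial, these weights give the degrees in \<open>f_r\<close> and
  \<open>x_r\<close> with their derivatives (\<open>wF\<close>, \<open>wX\<close>), the order in
  \<open>delta_0\<close> on both, read as the content of \<open>r\<close> (\<open>wO\<close>), the
  order on all \<open>x_r\<close> together, which fixes the sign (\<open>wS\<close>), and the degree
  in an underived variable (\<open>wC\<close>).\<close>

definition wF :: "reg \<Rightarrow> dvar \<Rightarrow> nat" where "wF r v = of_bool (fst v = fv r)"
definition wX :: "reg \<Rightarrow> dvar \<Rightarrow> nat" where "wX r v = of_bool (fst v = xv r)"
definition wO :: "reg \<Rightarrow> dvar \<Rightarrow> nat" where
  "wO r v = (if fst v = fv r \<or> fst v = xv r then Poly_Mapping.lookup (snd v) 0 else 0)"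
definition wS :: "dvar \<Rightarrow> nat" where
  "wS v = (if fst v \<in> range xv then Poly_Mapping.lookup (snd v) 0 else 0)"
definition wC :: "nat \<Rightarrow> dvar \<Rightarrow> nat" where "wC i v = of_bool (v = (i, 0))"

text \<open>The weight \<open>wJ\<close> counts the variables that must not occur in a configuration.\<close>
definition wJ :: "dvar \<Rightarrow> nat" where
  "wJ v = of_bool (\<not> (fst v \<le> 2 \<and> snd v = 0 \<or>
     fst v \<in> range fv \<union> range xv \<and> Poly_Mapping.keys (snd v) \<subseteq> {0}))"

definition val where
  "val P T J Z W F X O' S =
    (if T = 1 \<and> J = 0 \<and> Z + W = state_bound P \<and> (\<forall>r. F r = 1 \<and> X r = 1) \<and> \<not> accepts P Z O'
     then (-1) ^ S else (0::'a::comm_ring_1))"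

text \<open>The derivatives of \<open>f\<^sub>r\<close> and \<open>x\<^sub>r\<close> are read as \<open>S\<^sub>r\<^sup>k F\<^sub>r\<close> and \<open>(-S\<^sub>r)\<^sup>k X\<^sub>r\<close>, so that
  \<open>x\<^sub>r f\<^sub>r\<close> becomes a constant and the zero test applies to no other content of the register.\<close>
definition fnl :: "instr list \<Rightarrow> (dvar \<Rightarrow>\<^sub>0 nat) \<Rightarrow> 'a::comm_ring_1" where
  "fnl P c = val P (lin (wC 0) c) (lin wJ c) (lin (wC 1) c) (lin (wC 2) c)
     (\<lambda>r. lin (wF r) c) (\<lambda>r. lin (wX r) c) (\<lambda>r. lin (wO r) c) (lin wS c)"

lemma wC_dshift: "wC i (dshift l v) = 0"
proof -
  have "Poly_Mapping.lookup (snd v + Poly_Mapping.single l 1) l \<noteq> 0" by (simp add: lookup_add)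
  then have "snd v + Poly_Mapping.single l 1 \<noteq> 0" by (metis lookup_zero)
  then show ?thesis by (simp add: wC_def dshift_def)
qed

lemma lin_ge: "v \<in> Poly_Mapping.keys c \<Longrightarrow> w v \<le> lin w (c :: 'k \<Rightarrow>\<^sub>0 nat)"
proof -
  assume v: "v \<in> Poly_Mapping.keys c"
  then have "w v \<le> Poly_Mapping.lookup c v * w v" by (simp add: in_keys_iff)
  also have "\<dots> \<le> lin w c" unfolding lin_def by (rule member_le_sum) (use v in auto)
  finally show ?thesis .
qed

lemma fnl_junk:
  assumes "v \<in> Poly_Mapping.keys c" "wJ (dshift l v) = 1"
  shows "fnl P (replace_deriv l v c) = 0"
proof -
  have "lin wJ (replace_deriv l v c) > 0"
    using lin_replace_deriv[OF assms(1), of wJ l] lin_ge[OF assms(1), of wJ] assms(2) by simp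
  then show ?thesis by (simp add: fnl_def val_def)
qed

lemma wJ_dshift_other:
  assumes "l \<noteq> 0"
  shows "wJ (dshift l v) = 1"
proof -
  have "Poly_Mapping.lookup (snd v + Poly_Mapping.single l 1) l \<noteq> 0" by (simp add: lookup_add)
  then have "l \<in> Poly_Mapping.keys (snd v + Poly_Mapping.single l 1)" by (simp add: in_keys_iff)
  then have "snd v + Poly_Mapping.single l 1 \<noteq> 0"
    "\<not> Poly_Mapping.keys (snd v + Poly_Mapping.single l 1) \<subseteq> {0}" using assms by auto
  then show ?thesis by (simp add: wJ_def dshift_def)
qed

lemma wJ_dshift_const:
  assumes "fst v \<notin> range fv \<union> range xv"
  shows "wJ (dshift l v) = 1"
proof -
  have "Poly_Mapping.lookup (snd v + Poly_Mapping.single l 1) l \<noteq> 0" by (simp add: lookup_add)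
  then have "snd v + Poly_Mapping.single l 1 \<noteq> 0" by (metis lookup_zero)
  then show ?thesis using assms by (simp add: wJ_def dshift_def)
qed

lemma keys_add_nat:
  "Poly_Mapping.keys (a + b :: 'k \<Rightarrow>\<^sub>0 nat) = Poly_Mapping.keys a \<union> Poly_Mapping.keys b"
  by (auto simp: in_keys_iff lookup_add)

lemma wJ_dshift_reg:
  assumes "fst v \<in> range fv \<union> range xv"
  shows "wJ (dshift 0 v) = wJ v"
proof -
  have "2 < fst v" using assms by auto
  then show ?thesis using assms by (simp add: wJ_def dshift_def keys_add_nat)
qed

text \<open>Deriving a factor belonging to \<open>f_r\<close> or \<open>x_r\<close> raises the
  content of \<open>r\<close> by one, and in the second case also changes the sign. The value
  \<open>H r\<close> does not depend on which factor was chosen; deriving any other variable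
  produces a forbidden one.\<close>

lemma fnl_replace:
  fixes P :: "instr list"
  assumes v: "v \<in> Poly_Mapping.keys c"
  defines "H \<equiv> \<lambda>r. val P (lin (wC 0) c) (lin wJ c) (lin (wC 1) c) (lin (wC 2) c)
     (\<lambda>r. lin (wF r) c) (\<lambda>r. lin (wX r) c) ((\<lambda>r. lin (wO r) c)(r := Suc (lin (wO r) c))) (lin wS c)
     :: 'a::comm_ring_1"
  shows "fnl P (replace_deriv 0 v c) = (\<Sum>r\<in>UNIV. (of_nat (wF r v) - of_nat (wX r v)) * H r)"
proof -
  note rw = lin_replace_deriv[OF v, of _ 0]
  have C: "lin (wC i) (replace_deriv 0 v c) = lin (wC i) c" if "fst v \<in> range fv \<union> range xv" "i \<le> 2" for i
  proof -
    have "2 < fst v" using that(1) by auto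
    then have "wC i v = 0" using that(2) by (auto simp: wC_def)
    then show ?thesis using rw[of "wC i"] wC_dshift[of i 0 v] by simp
  qed
  have FX: "lin (wF r) (replace_deriv 0 v c) = lin (wF r) c" "lin (wX r) (replace_deriv 0 v c) = lin (wX r) c" for r
    using rw[of "wF r"] rw[of "wX r"] by (auto simp: wF_def wX_def dshift_def)
  have J: "lin wJ (replace_deriv 0 v c) = lin wJ c" if "fst v \<in> range fv \<union> range xv"
    using rw[of wJ] wJ_dshift_reg[OF that] by simp
  have O: "lin (wO r) (replace_deriv 0 v c) = lin (wO r) c + of_bool (fst v = fv r \<or> fst v = xv r)" for r
    using rw[of "wO r"] by (auto simp: wO_def dshift_def lookup_add)
  have S: "lin wS (replace_deriv 0 v c) = lin wS c + of_bool (fst v \<in> range xv)"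
    using rw[of wS] by (auto simp: wS_def dshift_def lookup_add)
  consider r where "fst v = fv r" | r where "fst v = xv r" | "fst v \<notin> range fv \<union> range xv" by blast
  then show ?thesis
  proof cases
    case 1
    have O': "(\<lambda>q. lin (wO q) (replace_deriv 0 v c)) = (\<lambda>r. lin (wO r) c)(r := Suc (lin (wO r) c))"
      using 1 by (auto simp: O)
    have "fnl P (replace_deriv 0 v c) = H r"
      using 1 unfolding fnl_def H_def O' by (auto simp: C FX J S)
    moreover have "(\<Sum>r\<in>UNIV. (of_nat (wF r v) - of_nat (wX r v)) * H r) = (\<Sum>q\<in>UNIV. if q = r then H r else 0)"
      using 1 by (intro sum.cong) (auto simp: wF_def wX_def)
    ultimately show ?thesis by simp
  next
    case 2
    have O': "(\<lambda>q. lin (wO q) (replace_deriv 0 v c)) = (\<lambda>r. lin (wO r) c)(r := Suc (lin (wO r) c))"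
      using 2 by (auto simp: O)
    have "fnl P (replace_deriv 0 v c) = - H r"
      using 2 unfolding fnl_def H_def O' by (auto simp: C FX J S val_def)
    moreover have "(\<Sum>r\<in>UNIV. (of_nat (wF r v) - of_nat (wX r v)) * H r) = (\<Sum>q\<in>UNIV. if q = r then - H r else 0)"
      using 2 by (intro sum.cong) (auto simp: wF_def wX_def)
    ultimately show ?thesis by simp
  next
    case 3
    then have "(\<Sum>r\<in>UNIV. (of_nat (wF r v) - of_nat (wX r v)) * H r) = 0"
      by (intro sum.neutral) (auto simp: wF_def wX_def)
    then show ?thesis using fnl_junk[OF v wJ_dshift_const[OF 3]] by simp
  qed
qed

text \<open>For \<open>delta_0\<close>, the sum over all factors multiplies \<open>H r\<close> by
  the degree in \<open>f_r\<close> minus the degree in \<open>x_r\<close>. Where \<open>H r\<close>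
  is nonzero both degrees are 1. Any other derivation creates a forbidden variable.\<close>

lemma fnl_kill:
  "(\<Sum>v\<in>Poly_Mapping.keys c. of_nat (Poly_Mapping.lookup c v) * fnl P (replace_deriv l v c)) = (0::'a::comm_ring_1)"
proof (cases "l = 0")
  case True
  define H :: "reg \<Rightarrow> 'a" where "H r = val P (lin (wC 0) c) (lin wJ c) (lin (wC 1) c) (lin (wC 2) c)
     (\<lambda>r. lin (wF r) c) (\<lambda>r. lin (wX r) c) ((\<lambda>r. lin (wO r) c)(r := Suc (lin (wO r) c))) (lin wS c)" for r
  let ?c = "\<lambda>v. of_nat (Poly_Mapping.lookup c v) :: 'a"
  have "(\<Sum>v\<in>Poly_Mapping.keys c. ?c v * fnl P (replace_deriv l v c)) =
      (\<Sum>v\<in>Poly_Mapping.keys c. ?c v * (\<Sum>r\<in>UNIV. (of_nat (wF r v) - of_nat (wX r v)) * H r))"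
    using True by (intro sum.cong) (simp_all only: fnl_replace H_def)
  also have "\<dots> = (\<Sum>v\<in>Poly_Mapping.keys c. \<Sum>r\<in>UNIV. (?c v * of_nat (wF r v) - ?c v * of_nat (wX r v)) * H r)"
    by (simp add: sum_distrib_left algebra_simps)
  also have "\<dots> = (\<Sum>r\<in>UNIV. \<Sum>v\<in>Poly_Mapping.keys c. (?c v * of_nat (wF r v) - ?c v * of_nat (wX r v)) * H r)"
    by (rule sum.swap)
  also have "\<dots> = (\<Sum>r\<in>UNIV. (of_nat (lin (wF r) c) - of_nat (lin (wX r) c)) * H r)"
    by (simp add: lin_def sum_subtractf flip: sum_distrib_right)
  also have "\<dots> = 0"
    by (intro sum.neutral) (auto simp: H_def val_def)
  finally show ?thesis .
next
  case False
  then show ?thesis by (intro sum.neutral) (auto simp: fnl_junk wJ_dshift_other)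
qed

lemma fnl_eq_zero: "lin (wC 0) c \<noteq> 1 \<Longrightarrow> fnl P c = 0" "lin wJ c \<noteq> 0 \<Longrightarrow> fnl P c = 0"
  by (auto simp: fnl_def val_def)

lemma wC_simps [simp]: "wC i (j, \<theta>) = of_bool (i = j \<and> \<theta> = 0)"
  by (auto simp: wC_def)

lemma wF_simps [simp]: "wF r (i, \<theta>) = of_bool (i = fv r)"
  by (simp add: wF_def)

lemma wX_simps [simp]: "wX r (i, \<theta>) = of_bool (i = xv r)"
  by (simp add: wX_def)

lemma wO_simps [simp]: "wO r (i, Poly_Mapping.single 0 k) = of_bool (i = fv r \<or> i = xv r) * k" "wO r (i, 0) = 0"
  by (simp_all add: wO_def)

lemma wS_simps [simp]: "wS (i, Poly_Mapping.single 0 k) = of_bool (i \<in> range xv) * k" "wS (i, 0) = 0"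
  by (simp_all add: wS_def)

lemma wJ_simps [simp]: "wJ (0, 0) = 0" "wJ (Suc 0, 0) = 0" "wJ (2, 0) = 0"
  "wJ (fv r, Poly_Mapping.single 0 k) = 0" "wJ (xv r, Poly_Mapping.single 0 k) = 0"
  "wJ (fv r, 0) = 0" "wJ (xv r, 0) = 0"
  by (auto simp: wJ_def)

lemma lin_eq_zero_iff: "lin w (c :: 'k \<Rightarrow>\<^sub>0 nat) = 0 \<longleftrightarrow> (\<forall>v\<in>Poly_Mapping.keys c. w v = 0)"
  by (auto simp: lin_def in_keys_iff)

lemma lin_wO_eq_zero: "lin (wF r) c = 0 \<Longrightarrow> lin (wX r) c = 0 \<Longrightarrow> lin (wO r) c = 0"
  unfolding lin_eq_zero_iff by (auto simp: wF_def wX_def wO_def)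

lemma lin_rule_desc:
  "lin g (interp (rule_desc m N q fs k fs')) =
    g (mono_of (fs @ state_facs m N q)) - g (mono_of (fs' @ state_facs m N k))"
  by (simp add: lin_interp rule_desc_def)

text \<open>The state of a rule already uses up the whole degree N in \<open>z\<close> and
  \<open>w\<close>. So either the cofactor contributes nothing to that degree and the addresses are
  exactly \<open>q\<close> and \<open>k\<close>, or both values are zero.\<close>

lemma val_cong:
  assumes "q \<le> state_bound P" "k \<le> state_bound P"
    and "(\<forall>r. F r = 1 \<and> X r = 1) \<Longrightarrow> accepts P q O' \<longleftrightarrow> accepts P k O''"
  shows "val P T J (Z + q) (W + state_bound P - q) F X O' S =
    val P T J (Z + k) (W + state_bound P - k) F X O'' S"
proof -
  have "Z + q + (W + state_bound P - q) = state_bound P \<longleftrightarrow> Z = 0 \<and> W = 0"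
    "Z + k + (W + state_bound P - k) = state_bound P \<longleftrightarrow> Z = 0 \<and> W = 0"
    using assms(1,2) by auto
  moreover define R where "R \<longleftrightarrow> (\<forall>r. F r = 1 \<and> X r = 1)"
  ultimately show ?thesis using assms(3) unfolding val_def R_def[symmetric]
    by (cases "Z = 0"; cases R) simp_all
qed

lemma fnl_instr:
  fixes u :: "dvar \<Rightarrow>\<^sub>0 nat"
  assumes m: "0 < m" and q: "q < length P" and d: "d \<in> set (instr_descs m (state_bound P) q (P ! q))"
  shows "lin (\<lambda>a. fnl P (u + a)) (interp d) = (0::'a::comm_ring_1)"
proof -
  have q': "q \<le> state_bound P" using q length_le_bound[of P] by simp
  let ?O = "\<lambda>x. lin (wO x) u"
  have O': "(\<lambda>x. lin (wO x) u + of_bool (r = x)) = ?O(r := Suc (?O r))" for r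
    by auto
  note [simp] = lin_rule_desc fnl_def
  show ?thesis
  proof (cases "P ! q")
    case (IncI r k)
    have k: "k \<le> state_bound P" using targets_le[OF q] IncI by simp
    have acc: "accepts P q ?O \<longleftrightarrow> accepts P k (\<lambda>x. lin (wO x) u + of_bool (r = x))"
      unfolding O' by (rule accepts_step[OF step_inc[OF q IncI]])
    have "d = rule_desc m (state_bound P) q [dfac m (fv r) 0 0] k [dfac m (fv r) 0 1]"
      using d IncI by simp
    then show ?thesis
      using m q' k by simp (rule val_cong[OF q' k acc])
  next
    case (DecI r k l)
    have k: "k \<le> state_bound P" and l: "l \<le> state_bound P" using targets_le[OF q] DecI by auto
    have acc: "accepts P q (\<lambda>x. lin (wO x) u + of_bool (r = x)) \<longleftrightarrow> accepts P k ?O"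
    proof -
      have "accepts P q (f(r := Suc (f r))) \<longleftrightarrow> accepts P k f" for f
        using accepts_step[OF step_dec[OF q DecI, of "f(r := Suc (f r))" "f r"]] by simp
      from this[of ?O] show ?thesis unfolding O' .
    qed
    \<comment> \<open>The rule supplies the only factors belonging to \<open>f_r\<close> and
      \<open>x_r\<close>. So \<open>u\<close> has none, the content of \<open>r\<close> is 0, and
      the zero branch is the step that the machine takes.\<close>
    have acc0: "accepts P q ?O \<longleftrightarrow> accepts P l ?O"
      if "\<forall>x. lin (wF x) u + of_bool (r = x) = 1 \<and> lin (wX x) u + of_bool (r = x) = 1"
      using lin_wO_eq_zero[of r u] that[rule_format, of r] step_zero[OF q DecI, of ?O]
      by (intro accepts_step) simp
    consider "d = rule_desc m (state_bound P) q [dfac m (fv r) 0 1] k [dfac m (fv r) 0 0]"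
      | "d = rule_desc m (state_bound P) q [dfac m (xv r) 0 0, dfac m (fv r) 0 0]
               l [dfac m (xv r) 0 0, dfac m (fv r) 0 0]"
      using d DecI by auto
    then show ?thesis
    proof cases
      case 1
      then show ?thesis using m q' k by simp (rule val_cong[OF q' k acc])
    next
      case 2
      then show ?thesis using m q' l by simp (rule val_cong[OF q' l acc0])
    qed
  next
    case (JmpI k)
    have k: "k \<le> state_bound P" using targets_le[OF q] JmpI by simp
    have "d = rule_desc m (state_bound P) q [] k []" using d JmpI by simp
    then show ?thesis
      using m q' k by simp (rule val_cong[OF q' k accepts_step[OF step_jmp[OF q JmpI]]])
  qed
qed

text \<open>Single variables and derivatives of \<open>t\<close> have degree 0 in underived
  \<open>t\<close>; products of \<open>t\<close> with derivatives of \<open>z\<close> or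
  \<open>w\<close> contain a forbidden variable; the accepting state accepts with any register
  contents.\<close>

lemma fnl_gens:
  assumes m: "0 < m" and d: "d \<in> set (gen_descs m P)" and u: "lin (wC 0) u = 0"
  shows "lin (\<lambda>a. fnl P (u + a)) (interp d) = (0::'a::comm_ring_1)"
proof -
  have *: "Poly_Mapping.single l (Suc 0) \<noteq> (0 :: nat \<Rightarrow>\<^sub>0 nat)" for l
    by (metis lookup_single_eq lookup_zero zero_neq_one One_nat_def)
  then have J: "wJ (1, Poly_Mapping.single l 1) = 1" "wJ (2, Poly_Mapping.single l 1) = 1" for l
    by (auto simp: wJ_def fv_def xv_def)
  from d consider
      i where "i \<in> {1..<19}" "d = [(1, [dfac m i 0 0])]"
    | l where "l < m" "d = [(1, [dfac m 0 l 1])]"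
    | l where "l < m" "d = [(1, [dfac m 0 0 0, dfac m 1 l 1])]"
    | l where "l < m" "d = [(1, [dfac m 0 0 0, dfac m 2 l 1])]"
    | "d = [(1, state_facs m (state_bound P) (length P))]"
    | q where "q < length P" "d \<in> set (instr_descs m (state_bound P) q (P ! q))"
    unfolding gen_descs_def by auto
  then show ?thesis
  proof cases
    case 1
    then show ?thesis using m u by (simp add: lin_interp fnl_eq_zero)
  next
    case 2
    then show ?thesis using m u * by (simp add: lin_interp fnl_eq_zero)
  next
    case 3
    then show ?thesis using m u J by (simp add: lin_interp fnl_eq_zero)
  next
    case 4
    then show ?thesis using m u J by (simp add: lin_interp fnl_eq_zero)
  next
    case 5
    then show ?thesis using accepts_final[of P] length_le_bound[of P]
      by (auto simp: lin_interp fnl_def val_def)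
  next
    case 6
    then show ?thesis using m fnl_instr by blast
  qed
qed

lemma lin_regs:
  assumes "0 < m"
  shows "lin w (mono_of (concat (map (\<lambda>r. [dfac m (fv r) 0 (s r), dfac m (xv r) 0 0]) regs))) =
    (\<Sum>r\<in>UNIV. w (fv r, Poly_Mapping.single 0 (s r)) + w (xv r, 0))"
proof -
  have "lin w (mono_of (concat (map (\<lambda>r. [dfac m (fv r) 0 (s r), dfac m (xv r) 0 0]) rs))) =
      (\<Sum>r\<leftarrow>rs. w (fv r, Poly_Mapping.single 0 (s r)) + w (xv r, 0))" for rs
    using assms by (induction rs) auto
  then show ?thesis
    unfolding set_regs[symmetric] sum.distinct_set_conv_list[OF distinct_regs] .
qed

lemma config_member_imp_accepts:
  assumes "(1::'a::comm_ring_1) \<noteq> 0" "0 < m"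
    and mem: "(interp (config_desc m (state_bound P) s) :: 'a dpoly) \<in> dsubalg m (interp ` set (gen_descs m P))"
  shows "accepts P 0 s"
proof (rule ccontr)
  assume "\<not> accepts P 0 s"
  let ?g = "fnl P :: _ \<Rightarrow> 'a"
  have "lin (\<lambda>a. ?g (0 + a)) (interp (config_desc m (state_bound P) s)) = 0"
  proof (rule lin_dsubalg_zero[OF _ _ _ _ mem])
    show "lin (wC 0) a = 1" if "?g a \<noteq> 0" for a using that fnl_eq_zero by blast
    show "wC 0 (dshift l v) = 0" for l v by (rule wC_dshift)
    show "lin (\<lambda>a. ?g (u + a)) p = 0" if "p \<in> interp ` set (gen_descs m P)" "lin (wC 0) u = 0" for p u
      using that fnl_gens assms(2) by blast
  qed (simp_all add: fnl_kill)
  \<comment> \<open>Knowing the value up to sign is enough: a power of -1 is nonzero in every ring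
    with 1 distinct from 0.\<close>
  moreover have "\<exists>e. lin (\<lambda>a. ?g (0 + a)) (interp (config_desc m (state_bound P) s)) = (-1) ^ e"
  proof -
    have "(\<Sum>q\<in>UNIV. of_bool (q = r) * f q) = (f r :: nat)" for r :: reg and f
      by (simp add: of_bool_def if_distrib[of "\<lambda>b. b * _"] cong: if_cong)
    from this[of _ "\<lambda>_. 1"] this[of _ s] have "?g (mono_of (config_facs m (state_bound P) s)) =
        (-1) ^ lin wS (mono_of (config_facs m (state_bound P) s))"
      using assms(2) \<open>\<not> accepts P 0 s\<close>
      by (simp add: fnl_def val_def config_facs_def lin_regs)
    then show ?thesis by (auto simp: config_desc_def lin_interp)
  qed
  ultimately obtain e where "(-1) ^ e = (0::'a)" by auto
  then show False using assms(1) by (metis minus_one_power_iff neg_equal_0_iff_equal)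
qed

section \<open>Running the machine inside the algebra\<close>

definition alg :: "nat \<Rightarrow> instr list \<Rightarrow> 'a::comm_ring_1 dpoly set" where
  "alg m P = dsubalg m (interp ` set (gen_descs m P))"

text \<open>As \<open>alg\<close> contains the derivatives of \<open>t\<close> but not \<open>t\<close> itself, the elements whose product with
  \<open>t\<close> stays in \<open>alg\<close> form a differential ideal of \<open>alg\<close>. Modulo this ideal the machine can be run.\<close>
definition conductor :: "nat \<Rightarrow> instr list \<Rightarrow> 'a::comm_ring_1 dpoly set" where
  "conductor m P = {h \<in> alg m P. dX (0, 0) * h \<in> alg m P}"

definition state_poly :: "instr list \<Rightarrow> nat \<Rightarrow> 'a::comm_ring_1 dpoly" where
  "state_poly P q = dX (1, 0) ^ q * dX (2, 0) ^ (state_bound P - q)"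

definition fpoly :: "reg \<Rightarrow> nat \<Rightarrow> 'a::comm_ring_1 dpoly" where
  "fpoly r k = dX (fv r, Poly_Mapping.single 0 k)"

definition xpoly :: "reg \<Rightarrow> 'a::comm_ring_1 dpoly" where
  "xpoly r = dX (xv r, 0)"

definition config_poly :: "instr list \<Rightarrow> nat \<Rightarrow> (reg \<Rightarrow> nat) \<Rightarrow> 'a::comm_ring_1 dpoly" where
  "config_poly P q s = state_poly P q * (\<Prod>r\<in>UNIV. fpoly r (s r) * xpoly r)"

lemma dconst_one [simp]: "dconst 1 = 1"
  unfolding dconst_def by (rule single_one)

lemma dconst_minus_one [simp]: "dconst (- 1) = - 1"
  unfolding dconst_def by (metis single_one single_uminus)

lemma interp_dfac [simp]: "l < m \<Longrightarrow> interp_factor (dfac m i l k) = dX (i, Poly_Mapping.single l k)"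
  by (simp add: interp_factor_def dfac_def theta_of_single)

lemma interp_state [simp]:
  "prod_list (map interp_factor (state_facs m (state_bound P) q)) = dX (0, 0) * state_poly P q"
  by (simp add: state_facs_def interp_factor_def state_poly_def)

lemma interp_monomial [simp]: "interp [(1, fs)] = prod_list (map interp_factor fs)"
  by (simp add: interp_def interp_term_def)

lemma interp_rule [simp]:
  "interp (rule_desc m (state_bound P) q fs k fs') =
     dX (0, 0) * (state_poly P q * prod_list (map interp_factor fs)
       - state_poly P k * prod_list (map interp_factor fs'))"
  by (simp add: interp_def interp_term_def rule_desc_def algebra_simps)

lemma interp_config:
  assumes "0 < m"
  shows "(interp (config_desc m (state_bound P) s) :: 'a::comm_ring_1 dpoly) = dX (0, 0) * config_poly P 0 s"
proof -
  have "prod_list (map interp_factor (concat (map (\<lambda>r. [dfac m (fv r) 0 (s r), dfac m (xv r) 0 0]) rs))) =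
      (\<Prod>r\<leftarrow>rs. fpoly r (s r) * xpoly r :: 'a dpoly)" for rs
    using assms by (induction rs) (auto simp: fpoly_def xpoly_def mult_ac)
  then show ?thesis
    unfolding config_poly_def set_regs[symmetric] prod.distinct_set_conv_list[OF distinct_regs]
    by (simp add: config_desc_def config_facs_def mult_ac)
qed

lemma alg_gen: "d \<in> set (gen_descs m P) \<Longrightarrow> interp d \<in> alg m P"
  unfolding alg_def by (intro dsubalg.gen) simp

lemma alg_one: "1 \<in> alg m P"
  using dsubalg.const[of 1] by (simp add: alg_def)

lemma alg_add: "p \<in> alg m P \<Longrightarrow> q \<in> alg m P \<Longrightarrow> p + q \<in> alg m P"
  unfolding alg_def by (rule dsubalg.add)

lemma alg_mult: "p \<in> alg m P \<Longrightarrow> q \<in> alg m P \<Longrightarrow> p * q \<in> alg m P"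
  unfolding alg_def by (rule dsubalg.mult)

lemma alg_uminus: "p \<in> alg m P \<Longrightarrow> - p \<in> alg m P"
proof -
  assume "p \<in> alg m P"
  moreover have "dconst (- 1) \<in> alg m P" unfolding alg_def by (rule dsubalg.const)
  ultimately have "dconst (- 1) * p \<in> alg m P" by (intro alg_mult)
  then show "- p \<in> alg m P" by simp
qed

lemma alg_diff: "p \<in> alg m P \<Longrightarrow> q \<in> alg m P \<Longrightarrow> p - q \<in> alg m P"
  using alg_add[OF _ alg_uminus, of p m P q] by simp

lemma alg_deriv: "l < m \<Longrightarrow> p \<in> alg m P \<Longrightarrow> dderiv l p \<in> alg m P"
  unfolding alg_def by (rule dsubalg.deriv)

lemma alg_power: "p \<in> alg m P \<Longrightarrow> p ^ n \<in> alg m P"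
  by (induction n) (auto intro: alg_one alg_mult)

lemma alg_prod: "(\<And>i. i \<in> I \<Longrightarrow> f i \<in> alg m P) \<Longrightarrow> prod f I \<in> alg m P"
  by (induction I rule: infinite_finite_induct) (auto intro: alg_one alg_mult)

context
  fixes m :: nat and P :: "instr list"
  assumes m: "0 < m"
begin

lemma alg_var: "0 < i \<Longrightarrow> i < 19 \<Longrightarrow> dX (i, 0) \<in> alg m P"
  using alg_gen[of "[(1, [dfac m i 0 0])]" m P] m by (simp add: gen_descs_def)

lemma alg_xpoly: "xpoly r \<in> alg m P"
  unfolding xpoly_def by (intro alg_var) auto

lemma alg_fpoly: "fpoly r k \<in> alg m P"
proof (induction k)
  case 0
  then show ?case unfolding fpoly_def by (simp add: alg_var)
next
  case (Suc k)
  from alg_deriv[OF m Suc] show ?case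
    by (simp add: fpoly_def dderiv_dX dshift_def flip: single_add)
qed

lemma dderiv_fpoly: "dderiv 0 (fpoly r k) = fpoly r (Suc k)"
  by (simp add: fpoly_def dderiv_dX dshift_def flip: single_add)

lemma alg_state: "state_poly P q \<in> alg m P"
  unfolding state_poly_def by (intro alg_mult alg_power alg_var) auto

lemma dderiv_t_in_alg: "dderiv 0 (dX (0, 0)) \<in> alg m P"
  using alg_gen[of "[(1, [dfac m 0 0 1])]" m P] m by (auto simp: gen_descs_def dderiv_dX dshift_def)

lemma conductor_add: "p \<in> conductor m P \<Longrightarrow> q \<in> conductor m P \<Longrightarrow> p + q \<in> conductor m P"
  by (auto simp: conductor_def distrib_left intro: alg_add)

lemma conductor_diff: "p \<in> conductor m P \<Longrightarrow> q \<in> conductor m P \<Longrightarrow> p - q \<in> conductor m P"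
  by (auto simp: conductor_def right_diff_distrib intro: alg_diff)

lemma conductor_mult: "p \<in> conductor m P \<Longrightarrow> q \<in> alg m P \<Longrightarrow> p * q \<in> conductor m P"
  by (auto simp: conductor_def intro: alg_mult simp flip: mult.assoc)

text \<open>By the Leibniz rule t p' = (t p)' - t' p, and t' is a generator.\<close>

lemma conductor_deriv:
  assumes "p \<in> conductor m P"
  shows "dderiv 0 p \<in> conductor m P"
proof -
  from assms have p: "p \<in> alg m P" "dX (0, 0) * p \<in> alg m P" by (auto simp: conductor_def)
  have "dX (0, 0) * dderiv 0 p = dderiv 0 (dX (0, 0) * p) - dderiv 0 (dX (0, 0)) * p"
    by (simp add: dderiv_times)
  also have "\<dots> \<in> alg m P"
    by (intro alg_diff alg_mult alg_deriv m p dderiv_t_in_alg)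
  finally show ?thesis using p alg_deriv[OF m] by (auto simp: conductor_def)
qed

lemma conductor_deriv_power:
  assumes "p \<in> alg m P" "dderiv 0 p \<in> conductor m P"
  shows "dderiv 0 (p ^ n) \<in> conductor m P"
proof (induction n)
  case 0
  have "(0 :: 'a dpoly) = dderiv 0 p - dderiv 0 p" by simp
  also have "\<dots> \<in> conductor m P" by (intro conductor_diff assms)
  finally show ?case
    by (simp add: dderiv_single dderiv_monom_eq flip: single_one)
next
  case (Suc n)
  have "dderiv 0 (p ^ Suc n) = dderiv 0 p * p ^ n + dderiv 0 (p ^ n) * p"
    by (simp add: dderiv_times mult_ac)
  also have "\<dots> \<in> conductor m P"
    by (intro conductor_add conductor_mult alg_power assms Suc)
  finally show ?case .
qed

lemma conductor_deriv_var:
  assumes "i \<in> {1, 2}"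
  shows "dderiv 0 (dX (i, 0)) \<in> conductor m P"
proof -
  have "[(1, [dfac m 0 0 0, dfac m i 0 1])] \<in> set (gen_descs m P)"
    using m assms by (auto simp: gen_descs_def)
  from alg_gen[OF this] have "dX (0, 0) * dderiv 0 (dX (i, 0)) \<in> alg m P"
    using m by (simp add: dderiv_dX dshift_def)
  moreover have "dderiv 0 (dX (i, 0)) \<in> alg m P" using assms by (intro alg_deriv m alg_var) auto
  ultimately show ?thesis by (simp add: conductor_def)
qed

lemma conductor_deriv_state: "dderiv 0 (state_poly P q) \<in> conductor m P"
proof -
  let ?n = "state_bound P - q"
  have "dderiv 0 (state_poly P q) =
      dderiv 0 (dX (1, 0) ^ q) * dX (2, 0) ^ ?n + dderiv 0 (dX (2, 0) ^ ?n) * dX (1, 0) ^ q"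
    by (simp add: state_poly_def dderiv_times mult_ac)
  also have "\<dots> \<in> conductor m P"
    by (intro conductor_add conductor_mult conductor_deriv_power conductor_deriv_var alg_power alg_var) auto
  finally show ?thesis .
qed

text \<open>State polynomials have derivatives in the ideal, so they act as constants modulo it, and
  differentiating a rule raises the content on both sides by one.\<close>

lemma conductor_shift:
  assumes "state_poly P q * fpoly r i - state_poly P k * fpoly r j \<in> (conductor m P :: 'a::comm_ring_1 dpoly set)"
  shows "state_poly P q * fpoly r (i + a) - state_poly P k * fpoly r (j + a) \<in> (conductor m P :: 'a dpoly set)"
proof (induction a)
  case 0
  then show ?case using assms by simp
next
  case (Suc a)
  have "(state_poly P q * fpoly r (i + Suc a) :: 'a dpoly) - state_poly P k * fpoly r (j + Suc a) =
     dderiv 0 (state_poly P q * fpoly r (i + a) - state_poly P k * fpoly r (j + a))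
      - (dderiv 0 (state_poly P q) * fpoly r (i + a) - dderiv 0 (state_poly P k) * fpoly r (j + a))"
    by (simp add: dderiv_diff dderiv_times dderiv_fpoly)
  also have "\<dots> \<in> conductor m P"
    by (rule conductor_diff, rule conductor_deriv[OF Suc])
      (intro conductor_diff conductor_mult conductor_deriv_state alg_fpoly)
  finally show ?case .
qed

lemma conductor_rule:
  assumes "q < length P" "rule_desc m (state_bound P) q fs k fs' \<in> set (instr_descs m (state_bound P) q (P ! q))"
    and "prod_list (map interp_factor fs) \<in> (alg m P :: 'a::comm_ring_1 dpoly set)"
    and "prod_list (map interp_factor fs') \<in> (alg m P :: 'a dpoly set)"
  shows "state_poly P q * prod_list (map interp_factor fs)
    - state_poly P k * prod_list (map interp_factor fs') \<in> (conductor m P :: 'a dpoly set)"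
proof -
  have "rule_desc m (state_bound P) q fs k fs' \<in> set (gen_descs m P)"
    using assms(1,2) by (auto simp: gen_descs_def)
  from alg_gen[OF this] show ?thesis
    unfolding conductor_def interp_rule by (auto intro: alg_diff alg_mult alg_state assms(3,4))
qed

definition others :: "reg \<Rightarrow> (reg \<Rightarrow> nat) \<Rightarrow> 'a::comm_ring_1 dpoly" where
  "others r s = (\<Prod>r\<in>UNIV - {r}. fpoly r (s r) * xpoly r)"

lemma config_poly_others: "config_poly P q s = state_poly P q * fpoly r (s r) * (xpoly r * others r s)"
  by (simp add: config_poly_def others_def prod.remove[of UNIV r] mult_ac)

lemma others_upd: "others r (s(r := k)) = others r s"
  unfolding others_def by (intro prod.cong) auto

lemma alg_others: "others r s \<in> alg m P"
  unfolding others_def by (intro alg_prod alg_mult alg_fpoly alg_xpoly)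

lemma conductor_config_upd:
  assumes "state_poly P q * fpoly r (s r) - state_poly P k * fpoly r j \<in> (conductor m P :: 'a::comm_ring_1 dpoly set)"
  shows "config_poly P q s - config_poly P k (s(r := j)) \<in> (conductor m P :: 'a dpoly set)"
proof -
  have "(config_poly P q s - config_poly P k (s(r := j)) :: 'a dpoly) =
     (state_poly P q * fpoly r (s r) - state_poly P k * fpoly r j) * (xpoly r * others r s)"
    by (simp add: config_poly_others[of _ _ r] others_upd left_diff_distrib)
  also have "\<dots> \<in> conductor m P"
    by (intro conductor_mult assms alg_mult alg_xpoly alg_others)
  finally show ?thesis .
qed

lemma conductor_step:
  assumes "step P (q, s) (q', s')"
  shows "config_poly P q s - config_poly P q' s' \<in> (conductor m P :: 'a::comm_ring_1 dpoly set)"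
  using assms
proof cases
  case (step_inc r)
  then have "state_poly P q * fpoly r 0 - state_poly P q' * fpoly r 1 \<in> (conductor m P :: 'a dpoly set)"
    using conductor_rule[of q "[dfac m (fv r) 0 0]" q' "[dfac m (fv r) 0 1]"] m alg_fpoly[of r 0] alg_fpoly[of r 1]
    by (simp add: fpoly_def)
  from conductor_shift[OF this, of "s r"] show ?thesis
    using step_inc by (auto intro: conductor_config_upd)
next
  case (step_dec r l j)
  then have "state_poly P q * fpoly r 1 - state_poly P q' * fpoly r 0 \<in> (conductor m P :: 'a dpoly set)"
    using conductor_rule[of q "[dfac m (fv r) 0 1]" q' "[dfac m (fv r) 0 0]"] m alg_fpoly[of r 0] alg_fpoly[of r 1]
    by (simp add: fpoly_def)
  from conductor_shift[OF this, of j] show ?thesis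
    using step_dec by (auto intro: conductor_config_upd)
next
  case (step_zero r k)
  let ?f = "[dfac m (xv r) 0 0, dfac m (fv r) 0 0]"
  have f: "prod_list (map interp_factor ?f) = xpoly r * fpoly r 0"
    using m by (simp add: fpoly_def xpoly_def)
  have "state_poly P q * (xpoly r * fpoly r 0) - state_poly P q' * (xpoly r * fpoly r 0)
      \<in> (conductor m P :: 'a dpoly set)"
    using conductor_rule[of q ?f q' ?f] step_zero unfolding f by (simp add: alg_mult alg_xpoly alg_fpoly)
  from conductor_mult[OF this alg_others, of r s] show ?thesis
    using step_zero by (simp add: config_poly_others[of _ _ r] left_diff_distrib mult.assoc mult.left_commute)
next
  case step_jmp
  then have "state_poly P q - state_poly P q' \<in> (conductor m P :: 'a dpoly set)"
    using conductor_rule[of q "[]" q' "[]"] by (simp add: alg_one)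
  from conductor_mult[OF this, of "\<Prod>r\<in>UNIV. fpoly r (s r) * xpoly r"] show ?thesis
    using step_jmp by (simp add: config_poly_def left_diff_distrib alg_prod alg_mult alg_fpoly alg_xpoly)
qed

lemma conductor_final: "config_poly P (length P) s \<in> (conductor m P :: 'a::comm_ring_1 dpoly set)"
proof -
  have "[(1, state_facs m (state_bound P) (length P))] \<in> set (gen_descs m P)"
    by (simp add: gen_descs_def)
  from alg_gen[OF this] have "state_poly P (length P) \<in> (conductor m P :: 'a dpoly set)"
    by (simp add: conductor_def alg_state)
  then show ?thesis
    unfolding config_poly_def by (intro conductor_mult alg_prod alg_mult alg_fpoly alg_xpoly)
qed

lemma conductor_steps:
  assumes "(step P)\<^sup>*\<^sup>* (q, s) (length P, t)"
  shows "config_poly P q s \<in> conductor m P"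
  using assms
proof (induction rule: converse_rtranclp_induct2)
  case refl
  then show ?case by (rule conductor_final)
next
  case (step q s q' s')
  from conductor_add[OF conductor_step[OF step.hyps(1)] step.IH] show ?case by simp
qed

end

theorem config_member_iff_accepts:
  assumes "(1::'a::comm_ring_1) \<noteq> 0" "0 < m"
  shows "(interp (config_desc m (state_bound P) s) :: 'a dpoly) \<in> dsubalg m (interp ` set (gen_descs m P))
    \<longleftrightarrow> accepts P 0 s"
proof
  assume "accepts P 0 s"
  then obtain t where "(step P)\<^sup>*\<^sup>* (0, s) (length P, t)" unfolding accepts_def by blast
  from conductor_steps[OF assms(2) this]
  have "(config_poly P 0 s :: 'a dpoly) \<in> conductor m P" .
  then show "(interp (config_desc m (state_bound P) s) :: 'a dpoly) \<in> dsubalg m (interp ` set (gen_descs m P))"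
    unfolding interp_config[OF assms(2)] by (simp add: conductor_def alg_def)
qed (rule config_member_imp_accepts[OF assms])

section \<open>Diagonalisation\<close>

fun add_const :: "reg \<Rightarrow> nat \<Rightarrow> cmd" where
  "add_const r 0 = Skip"
| "add_const r (Suc k) = Inc r ;; add_const r k"

lemma ex_add_const: "ex (add_const r k) s (s(r := s r + k))"
proof (induction k arbitrary: s)
  case (Suc k)
  from ex_Seq[OF ex_Inc Suc[of "s(r := Suc (s r))"]] show ?case
    by (simp only: add_const.simps fun_upd_same fun_upd_upd add_Suc add_Suc_right)
qed (simp add: ex_steps)

text \<open>The remaining factors of an initial configuration depend on the bound of the very program that is to
  write them down, so their code is taken from the input.\<close>
definition prelude :: "nat \<Rightarrow> cmd" where
  "prelude m = copy RA RX ;; Inc RA ;; pop RA RY ;;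
     add_const RZ (list_encode (replicate (m - 1) 0)) ;; push RX RZ ;;
     add_const RX (list_encode [1]) ;; push RZ RX ;;
     add_const RZ (fv RA) ;; push RZ RX ;; push RX RY ;;
     add_const RX (int_encode 1) ;; pair RX RY ;; push RY RX ;; pair RX RA ;; push RA RZ ;; move RZ RA"

definition input :: "nat \<Rightarrow> reg \<Rightarrow> nat" where
  "input x = (\<lambda>_. 0)(RA := x)"

text \<open>\<open>regs\<close> begins with \<open>RA\<close>, so the factor cut off is the one for
  the content of \<open>RA\<close>, the only one that varies with the input.\<close>

definition rest_facs :: "nat \<Rightarrow> nat \<Rightarrow> dfactor list" where
  "rest_facs m N = tl (config_facs m N (\<lambda>_. 0))"

lemma config_facs_input: "config_facs m N (input x) = dfac m (fv RA) 0 x # rest_facs m N"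
  by (simp add: config_facs_def rest_facs_def regs_def input_def)

text \<open>The first \<open>Inc\<close> gives the bare pair \<open>x\<close> the successor that
  \<open>pop\<close> expects. The codes of the exponent list, the factor, the term, the description
  and the instance are then built from the inside out.\<close>

lemma ex_prelude:
  assumes "0 < m" "x = prod_encode (list_encode (map encode_factor (rest_facs m N)), list_encode (map encode_desc gs))"
  shows "ex (prelude m) (input x) (input (list_encode [encode_instance (config_desc m N (input x), gs)]))"
proof -
  from assms(1) obtain j where m: "m = Suc j" by (cases m) auto
  note [simp] = ex_steps ex_seq_iff[OF ex_add_const]
  show ?thesis
    by (auto simp: prelude_def input_def encode_instance_def encode_desc_def encode_term_def
        config_desc_def config_facs_input[unfolded input_def] encode_factor_def dfac_def m assms(2) fun_eq_iff
        simp del: add_const.simps)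
qed

section \<open>Well-formedness of the instances\<close>

lemma valid_state_facs:
  "fa \<in> set (state_facs m N q) \<Longrightarrow> fst fa < 19 \<and> length (fst (snd fa)) = m"
  by (auto simp: state_facs_def)

lemma valid_dfac: "i < 19 \<Longrightarrow> fst (dfac m i l k) < 19 \<and> length (fst (snd (dfac m i l k))) = m"
  by (simp add: dfac_def)

lemma valid_rule:
  assumes "\<forall>fa\<in>set fs \<union> set fs'. fst fa < 19 \<and> length (fst (snd fa)) = m"
  shows "valid_desc m 19 (rule_desc m N q fs k fs')"
  using assms valid_state_facs by (auto simp: valid_desc_def rule_desc_def)

lemma valid_instr: "d \<in> set (instr_descs m N q i) \<Longrightarrow> valid_desc m 19 d"
  by (cases i) (auto intro!: valid_rule simp: dfac_def)

lemma valid_config: "valid_desc m 19 (config_desc m N s)"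
  by (auto simp: valid_desc_def config_desc_def config_facs_def valid_dfac dest: valid_state_facs)

lemma valid_gens: "d \<in> set (gen_descs m P) \<Longrightarrow> valid_desc m 19 d"
  by (auto simp: gen_descs_def valid_desc_def[of _ _ "[_]"] valid_dfac dest: valid_state_facs valid_instr)

theorem theorem2:
  fixes m :: nat
  assumes "(1::'a::comm_ring_1) \<noteq> 0"
    and "m \<ge> 2"
  shows "\<exists>n. \<not> dsm_decidable TYPE('a) m n"
proof (intro exI[of _ 19] notI)
  \<comment> \<open>The number 19 of variables is fixed before the decision procedure
    \<open>F\<close> is obtained.\<close>
  assume "dsm_decidable TYPE('a) m 19"
  then obtain F where F: "\<And>f fs. valid_desc m 19 f \<Longrightarrow> \<forall>g\<in>set fs. valid_desc m 19 g \<Longrightarrow>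
      reval F [encode_instance (f, fs)]
        (if (interp f :: 'a dpoly) \<in> dsubalg m (interp ` set fs) then 1 else 0)"
    unfolding dsm_decidable_def by blast
  from assms(2) have m: "0 < m" by simp
  define c where "c = prelude m ;; compile F"
  define P where "P = machine c"
  let ?gs = "gen_descs m P" and ?N = "state_bound P"
  \<comment> \<open>There is no circularity: \<open>P\<close> depends only on \<open>m\<close> and
    \<open>F\<close>, and the data describing \<open>P\<close> enter through the input
    \<open>x\<close>, whose own code \<open>prelude\<close> inserts at run time.\<close>
  define x where "x = prod_encode (list_encode (map encode_factor (rest_facs m ?N)), list_encode (map encode_desc ?gs))"
  define f where "f = config_desc m ?N (input x)"
  define y :: nat where "y = (if (interp f :: 'a dpoly) \<in> dsubalg m (interp ` set ?gs) then 1 else 0)"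
  have "reval F [encode_instance (f, ?gs)] y"
    unfolding y_def by (rule F) (simp_all add: f_def valid_config valid_gens)
  then have "ex (compile F) (input (list_encode [encode_instance (f, ?gs)]))
      ((input (list_encode [encode_instance (f, ?gs)]))(RA := y))"
    by (intro computes_ex[OF compile_correct, of F "[encode_instance (f, ?gs)]"]) (simp_all add: idle_def input_def)
  with ex_prelude[OF m x_def] have "ex c (input x) ((input (list_encode [encode_instance (f, ?gs)]))(RA := y))"
    unfolding c_def f_def by (rule ex_Seq)
  \<comment> \<open>The machine accepts exactly when \<open>F\<close> denies membership, whereas
    membership is equivalent to acceptance.\<close>
  then have "accepts P 0 (input x) \<longleftrightarrow> y = 0"
    unfolding P_def by (simp add: accepts_machine)
  then show False
    using config_member_iff_accepts[OF assms(1) m, of P "input x"] unfolding y_def f_def by auto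
qed

end
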